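(* Let $E$ be a quasi-Banach ideal space with the Fatou property over $(T,\Sigma,\mu)$ and let $\varphi$ be an Orlicz function with $a_\varphi<b_\varphi$ and $\alpha^E_\varphi>0$. Let $\mu$ be nonatomic. (i) Let $L_\infty\subset E$ and $E_a\ne\{0\}$. If $\varphi\notin\Delta_2^E$ (i.e. $\varphi\notin\Delta_2(\infty)$), then the space $E_\varphi$ contains an order linearly isometric copy of $l_\infty$. (ii) Assume that neither $L_\infty\subset E$ nor $E\subset L_\infty$ and $\operatorname{supp}(E_a)=T$. If $\varphi\notin\Delta_2^E$ (i.e. $\varphi\notin\Delta_2(\mathbb R_+)$), then the space $E_\varphi$ contains an order linearly isometric copy of $l_\infty$.
   Context: $(T,\Sigma,\mu)$ is a complete $\sigma$-finite measure space with $\mu(T)>0$; $L^0$ is the space of ($\mu$-a.e. classes of) real $\Sigma$-measurable functions on $T$, with the a.e. order; $L_\infty=L_\infty(T,\Sigma,\mu)$. A quasi-norm is a functional satisfying the axioms of a norm with the triangle inequality replaced by $\|x+y\|\le C(\|x\|+\|y\|)$ for some constant $C\ge1$. A quasi-Banach ideal space is a linear subspace $E\subset L^0$ with a complete quasi-norm $\|\cdot\|_E$ such that (i) $x\in L^0$, $y\in E$, $|x|\le|y|$ a.e. imply $x\in E$, $\|x\|_E\le\|y\|_E$; (ii) some $x\in E$ is strictly positive on $T$. $E$ has the Fatou property if $0\le x_n\uparrow|x|$ a.e., $x_n\in E$, $x\in L^0$, $\sup_n\|x_n\|_E<\infty$ imply $x\in E$ and $\|x_n\|_E\to\|x\|_E$.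 $E_a$ is the set (an order ideal) of order continuous elements: those $x\in E$ such that $\|x_n\|_E\to0$ for every sequence with $0\le x_n\le|x|$ and $x_n\to0$ a.e. The support of an order ideal $F\subset L^0$ is the smallest (up to null sets) $S\in\Sigma$ such that every $x\in F$ vanishes a.e. outside $S$. An Orlicz function is a non-decreasing $\varphi:[0,\infty)\to[0,\infty]$ with $\varphi(0)=0$, right continuous at $0$, continuous on $(0,b_\varphi)$ and left continuous at $b_\varphi$, where $b_\varphi=\sup\{u\ge0:\varphi(u)<\infty\}$, and with $\lim_{u\to\infty}\varphi(u)=\infty$. $a_\varphi=\sup\{u\ge0:\varphi(u)=0\}$. $\varphi\in\Delta_2(\mathbb R_+)$: there is $K>0$ with $\varphi(2u)\le K\varphi(u)$ for all $u\ge0$ (for $a_\varphi<b_\varphi$ this forces $a_\varphi=0$, $b_\varphi=\infty$). $\varphi\in\Delta_2(\infty)$: there are $K,u_0\in(0,\infty)$ with $\varphi(u_0)<\infty$ and $\varphi(2u)\le K\varphi(u)$ for all $u\ge u_0$. Indices: $\alpha^a_\varphi$ is the supremum of $p\in\mathbb R$ for which there is $K\ge1$ with $\varphi(au)\le Ka^p\varphi(u)$ for all $u\ge0$, $0<a\le1$; $\alpha^\infty_\varphi$ is the same with the inequality required only for $u\ge u_0$, for some $u_0>0$ with $\varphi(u_0)<\infty$. Here $\alpha^E_\varphi=\alpha^a_\varphi$ if neither $L_\infty\subset E$ nor $E\subset L_\infty$, and $\alpha^E_\varphi=\alpha^\infty_\varphi$ if $L_\infty\subset E$. $\rho^E_\varphi(x)=\|\varphi(|x|)\|_E$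 if $\varphi(|x|)\in E$, and $=\infty$ otherwise; $E_\varphi=\{x\in L^0:\rho^E_\varphi(\lambda x)<\infty\text{ for some }\lambda>0\}$ with the quasi-norm $\|x\|_\varphi=\inf\{\lambda>0:\rho^E_\varphi(x/\lambda)\le1\}$. A quasi-normed ideal space $F$ contains an order linearly isometric copy of $l_\infty$ if there is a linear map $P:l_\infty\to F$ with $\|Pz\|_F=\|z\|_{l_\infty}$ and $|Pz|=P|z|$ for all $z\in l_\infty$ (in particular $Pz\ge0$ when $z\ge0$). *)

theory Defs
  imports "HOL-Analysis.Analysis"
begin

text \<open>
  Elements of \<open>L\<^sup>0\<close> are represented by measurable functions, and equality and order of classes
  by equality and order almost everywhere. An ideal space is thus a set \<open>E\<close> of measurable
  functions with a functional \<open>N\<close>, of which only the values on \<open>E\<close> matter. Solidity forces \<open>E\<close> and \<open>N\<close>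
  to respect almost everywhere equality.
\<close>

definition nonatomic :: "'a measure \<Rightarrow> bool" where
  "nonatomic M \<longleftrightarrow>
     (\<forall>A\<in>sets M. 0 < emeasure M A \<longrightarrow>
        (\<exists>B\<in>sets M. B \<subseteq> A \<and> 0 < emeasure M B \<and> emeasure M B < emeasure M A))"

definition Linf :: "'a measure \<Rightarrow> ('a \<Rightarrow> real) set" where
  "Linf M = {x \<in> borel_measurable M. \<exists>C. AE t in M. \<bar>x t\<bar> \<le> C}"

definition quasi_norm_on :: "'a measure \<Rightarrow> ('a \<Rightarrow> real) set \<Rightarrow> (('a \<Rightarrow> real) \<Rightarrow> real) \<Rightarrow> bool" where
  "quasi_norm_on M E N \<longleftrightarrow>
     (\<forall>x\<in>E. 0 \<le> N x) \<and>
     (\<forall>x\<in>E. N x = 0 \<longleftrightarrow> (AE t in M. x t = 0)) \<and>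
     (\<forall>x\<in>E. \<forall>c. N (\<lambda>t. c * x t) = \<bar>c\<bar> * N x) \<and>
     (\<exists>C\<ge>1. \<forall>x\<in>E. \<forall>y\<in>E. N (\<lambda>t. x t + y t) \<le> C * (N x + N y))"

definition complete_on :: "('a \<Rightarrow> real) set \<Rightarrow> (('a \<Rightarrow> real) \<Rightarrow> real) \<Rightarrow> bool" where
  "complete_on E N \<longleftrightarrow>
     (\<forall>X :: nat \<Rightarrow> 'a \<Rightarrow> real. range X \<subseteq> E \<longrightarrow>
        (\<forall>e>0. \<exists>k. \<forall>m\<ge>k. \<forall>n\<ge>k. N (\<lambda>t. X m t - X n t) < e) \<longrightarrow>
        (\<exists>x\<in>E. (\<lambda>n. N (\<lambda>t. X n t - x t)) \<longlonglongrightarrow> 0))"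

definition quasi_Banach_ideal_space ::
    "'a measure \<Rightarrow> ('a \<Rightarrow> real) set \<Rightarrow> (('a \<Rightarrow> real) \<Rightarrow> real) \<Rightarrow> bool" where
  "quasi_Banach_ideal_space M E N \<longleftrightarrow>
     E \<subseteq> borel_measurable M \<and>
     (\<lambda>t. 0) \<in> E \<and>
     (\<forall>x\<in>E. \<forall>y\<in>E. (\<lambda>t. x t + y t) \<in> E) \<and>
     (\<forall>x\<in>E. \<forall>c. (\<lambda>t. c * x t) \<in> E) \<and>
     quasi_norm_on M E N \<and>
     complete_on E N \<and>
     (\<forall>x\<in>borel_measurable M. \<forall>y\<in>E. (AE t in M. \<bar>x t\<bar> \<le> \<bar>y t\<bar>) \<longrightarrow> x \<in> E \<and> N x \<le> N y) \<and>
     (\<exists>x\<in>E. AE t in M. 0 < x t)"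

definition Fatou_property ::
    "'a measure \<Rightarrow> ('a \<Rightarrow> real) set \<Rightarrow> (('a \<Rightarrow> real) \<Rightarrow> real) \<Rightarrow> bool" where
  "Fatou_property M E N \<longleftrightarrow>
     (\<forall>(X :: nat \<Rightarrow> 'a \<Rightarrow> real) x.
        range X \<subseteq> E \<longrightarrow> x \<in> borel_measurable M \<longrightarrow>
        (AE t in M. (\<forall>n. 0 \<le> X n t) \<and> incseq (\<lambda>n. X n t) \<and> (\<lambda>n. X n t) \<longlonglongrightarrow> \<bar>x t\<bar>) \<longrightarrow>
        bdd_above (range (\<lambda>n. N (X n))) \<longrightarrow>
        x \<in> E \<and> (\<lambda>n. N (X n)) \<longlonglongrightarrow> N x)"

text \<open>The ideal \<open>E\<^sub>a\<close>; the minorants \<open>X n\<close> lie in \<open>E\<close> by solidity.\<close>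

definition order_continuous_part ::
    "'a measure \<Rightarrow> ('a \<Rightarrow> real) set \<Rightarrow> (('a \<Rightarrow> real) \<Rightarrow> real) \<Rightarrow> ('a \<Rightarrow> real) set" where
  "order_continuous_part M E N =
     {x \<in> E. \<forall>X :: nat \<Rightarrow> 'a \<Rightarrow> real.
        range X \<subseteq> borel_measurable M \<longrightarrow>
        (\<forall>n. AE t in M. 0 \<le> X n t \<and> X n t \<le> \<bar>x t\<bar>) \<longrightarrow>
        (AE t in M. (\<lambda>n. X n t) \<longlonglongrightarrow> 0) \<longrightarrow>
        (\<lambda>n. N (X n)) \<longlonglongrightarrow> 0}"

text \<open>Supports are determined only up to null sets, hence a relation.\<close>

definition is_support :: "'a measure \<Rightarrow> ('a \<Rightarrow> real) set \<Rightarrow> 'a set \<Rightarrow> bool" where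
  "is_support M F S \<longleftrightarrow>
     S \<in> sets M \<and>
     (\<forall>x\<in>F. AE t in M. t \<notin> S \<longrightarrow> x t = 0) \<and>
     (\<forall>S'\<in>sets M. (\<forall>x\<in>F. AE t in M. t \<notin> S' \<longrightarrow> x t = 0) \<longrightarrow> (AE t in M. t \<in> S \<longrightarrow> t \<in> S'))"

text \<open>
  A function \<open>[0,\<infinity>) \<rightarrow> [0,\<infinity>]\<close> is represented by a function on the whole real line whose values at
  negative arguments are irrelevant throughout.
\<close>

definition a_param :: "(real \<Rightarrow> ennreal) \<Rightarrow> ereal" where
  "a_param \<phi> = Sup {ereal u |u. 0 \<le> u \<and> \<phi> u = 0}"

definition b_param :: "(real \<Rightarrow> ennreal) \<Rightarrow> ereal" where
  "b_param \<phi> = Sup {ereal u |u. 0 \<le> u \<and> \<phi> u < \<infinity>}"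

definition Orlicz_function :: "(real \<Rightarrow> ennreal) \<Rightarrow> bool" where
  "Orlicz_function \<phi> \<longleftrightarrow>
     mono_on {0..} \<phi> \<and>
     \<phi> 0 = 0 \<and>
     continuous (at_right 0) \<phi> \<and>
     continuous_on {u. 0 < u \<and> ereal u < b_param \<phi>} \<phi> \<and>
     (\<forall>u. 0 < u \<and> ereal u = b_param \<phi> \<longrightarrow> continuous (at_left u) \<phi>) \<and>
     (\<phi> \<longlongrightarrow> \<infinity>) at_top"

definition Delta2_Rplus :: "(real \<Rightarrow> ennreal) \<Rightarrow> bool" where
  "Delta2_Rplus \<phi> \<longleftrightarrow> (\<exists>K>0. \<forall>u\<ge>0. \<phi> (2 * u) \<le> ennreal K * \<phi> u)"

definition Delta2_infty :: "(real \<Rightarrow> ennreal) \<Rightarrow> bool" where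
  "Delta2_infty \<phi> \<longleftrightarrow>
     (\<exists>K>0. \<exists>u0>0. \<phi> u0 < \<infinity> \<and> (\<forall>u\<ge>u0. \<phi> (2 * u) \<le> ennreal K * \<phi> u))"

definition alpha_a :: "(real \<Rightarrow> ennreal) \<Rightarrow> ereal" where
  "alpha_a \<phi> = Sup {ereal p |p. \<exists>K\<ge>1. \<forall>u\<ge>0. \<forall>a. 0 < a \<and> a \<le> 1 \<longrightarrow>
                       \<phi> (a * u) \<le> ennreal (K * a powr p) * \<phi> u}"

definition alpha_infty :: "(real \<Rightarrow> ennreal) \<Rightarrow> ereal" where
  "alpha_infty \<phi> = Sup {ereal p |p. \<exists>K\<ge>1. \<exists>u0>0. \<phi> u0 < \<infinity> \<and>
                       (\<forall>u\<ge>u0. \<forall>a. 0 < a \<and> a \<le> 1 \<longrightarrow>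
                          \<phi> (a * u) \<le> ennreal (K * a powr p) * \<phi> u)}"

text \<open>The index is left unspecified if \<open>E\<close> is contained in \<open>L\<^sub>\<infinity>\<close> but does not contain it.\<close>

definition alpha_E :: "'a measure \<Rightarrow> ('a \<Rightarrow> real) set \<Rightarrow> (real \<Rightarrow> ennreal) \<Rightarrow> ereal" where
  "alpha_E M E \<phi> =
     (if Linf M \<subseteq> E then alpha_infty \<phi>
      else if \<not> E \<subseteq> Linf M then alpha_a \<phi>
      else undefined)"

text \<open>
  \<open>\<phi>(|x|)\<close> represents an element of \<open>L\<^sup>0\<close> only if it is finite almost everywhere; this is part of
  its membership in \<open>E\<close>.
\<close>

definition rho ::
    "'a measure \<Rightarrow> ('a \<Rightarrow> real) set \<Rightarrow> (('a \<Rightarrow> real) \<Rightarrow> real) \<Rightarrow> (real \<Rightarrow> ennreal) \<Rightarrow>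
     ('a \<Rightarrow> real) \<Rightarrow> ennreal" where
  "rho M E N \<phi> x =
     (if (AE t in M. \<phi> \<bar>x t\<bar> < \<infinity>) \<and> (\<lambda>t. enn2real (\<phi> \<bar>x t\<bar>)) \<in> E
      then ennreal (N (\<lambda>t. enn2real (\<phi> \<bar>x t\<bar>)))
      else \<infinity>)"

definition E_phi ::
    "'a measure \<Rightarrow> ('a \<Rightarrow> real) set \<Rightarrow> (('a \<Rightarrow> real) \<Rightarrow> real) \<Rightarrow> (real \<Rightarrow> ennreal) \<Rightarrow>
     ('a \<Rightarrow> real) set" where
  "E_phi M E N \<phi> = {x \<in> borel_measurable M. \<exists>l>0. rho M E N \<phi> (\<lambda>t. l * x t) < \<infinity>}"

definition norm_phi ::
    "'a measure \<Rightarrow> ('a \<Rightarrow> real) set \<Rightarrow> (('a \<Rightarrow> real) \<Rightarrow> real) \<Rightarrow> (real \<Rightarrow> ennreal) \<Rightarrow>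
     ('a \<Rightarrow> real) \<Rightarrow> real" where
  "norm_phi M E N \<phi> x = Inf {l. 0 < l \<and> rho M E N \<phi> (\<lambda>t. x t / l) \<le> 1}"

definition l_infty :: "(nat \<Rightarrow> real) set" where
  "l_infty = {z. Bseq z}"

definition l_infty_norm :: "(nat \<Rightarrow> real) \<Rightarrow> real" where
  "l_infty_norm z = (SUP n. \<bar>z n\<bar>)"

text \<open>The map \<open>P\<close> picks representatives, so its linearity and \<open>|P z| = P |z|\<close> hold almost everywhere.\<close>

definition contains_order_isometric_copy_l_infty ::
    "'a measure \<Rightarrow> ('a \<Rightarrow> real) set \<Rightarrow> (('a \<Rightarrow> real) \<Rightarrow> real) \<Rightarrow> bool" where
  "contains_order_isometric_copy_l_infty M F NF \<longleftrightarrow>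
     (\<exists>P :: (nat \<Rightarrow> real) \<Rightarrow> 'a \<Rightarrow> real.
        (\<forall>z\<in>l_infty. P z \<in> F) \<and>
        (\<forall>z\<in>l_infty. \<forall>w\<in>l_infty. AE t in M. P (\<lambda>n. z n + w n) t = P z t + P w t) \<and>
        (\<forall>z\<in>l_infty. \<forall>c. AE t in M. P (\<lambda>n. c * z n) t = c * P z t) \<and>
        (\<forall>z\<in>l_infty. NF (P z) = l_infty_norm z) \<and>
        (\<forall>z\<in>l_infty. AE t in M. \<bar>P z t\<bar> = P (\<lambda>n. \<bar>z n\<bar>) t))"

end

theory Submission
  imports Defs
begin

text \<open>
  The idea is to build disjoint sets \<open>A\<^sub>k\<close> and heights \<open>u\<^sub>k\<close> such that the step function with value
  \<open>u\<^sub>k\<close> on \<open>A\<^sub>k\<close> has modular at most \<open>1\<close>, while dilating its \<open>k\<close>-th block alone by \<open>1 + 1/(k+1)\<close> makes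
  the modular exceed \<open>1\<close>. If the blocks are distributed over the coordinates of
  a bounded sequence so that every coordinate gets infinitely many of them, then multiplying each
  block by its coordinate is the desired isometry: the first property bounds the norm of the image
  from above by the supremum of the coordinates, the second bounds it from below by each coordinate
  (\<open>copy_of_blocks\<close>).

  The heights come from the failure of the doubling condition. If \<open>\<phi> (l * u) \<le> K * \<phi> u\<close> held for some
  \<open>l > 1\<close> and \<open>K\<close>, iteration would give the doubling condition (\<open>doubling_of_dilation\<close>). So for every
  \<open>l > 1\<close>, however close to \<open>1\<close>, and every \<open>K\<close> there is \<open>u\<close> with \<open>\<phi> (l * u) > K * \<phi> u\<close>. With
  $\varepsilon_k = (2C)^{-(k+1)}$, where \<open>C\<close> is the constant of the quasi-triangle inequality, one takes
  \<open>K\<close> of order $C/\varepsilon_k$. If \<open>\<phi> u\<^sub>k\<close> times the indicator of \<open>A\<^sub>k\<close> has quasi-norm between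
  $\varepsilon_k/(2C)$ and $\varepsilon_k$, then both properties hold (when \<open>\<phi>\<close> is \<open>0\<close> at \<open>u\<^sub>k\<close> or \<open>\<infinity>\<close> at the
  dilated height, \<open>block_scale\<close> adjusts the size), as blocks with such quasi-norms are summable by the Fatou property
  (\<open>geometric_sum_N_le_1\<close>).

  The sets come from order continuity and the absence of atoms. Inside a set with indicator in \<open>E\<^sub>a\<close>,
  the quasi-norm of the indicator of a subset takes every smaller positive value up to a factor \<open>2 * C\<close>
  (\<open>set_norm_intermediate\<close>). It remains to have enough room for infinitely many disjoint blocks. If \<open>E\<close>
  contains the bounded functions, the blocks must be small, which is possible because the heights can
  be taken so that \<open>\<phi> u\<^sub>k\<close> is large or \<open>\<phi>\<close> becomes infinite at the dilated height. If \<open>E\<close> does not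
  contain the bounded functions and \<open>E\<^sub>a\<close> has full support, there are arbitrarily large sets with
  indicator in \<open>E\<^sub>a\<close> outside any finite number of blocks (\<open>Ea_large_subset\<close>), so the heights may be
  arbitrary.
\<close>

section \<open>Exhaustion in sigma-finite and nonatomic measure spaces\<close>

text \<open>
  A greedy exhaustion: each step gains at least the best possible gain up to $1/(n+1)$, so nothing
  of positive measure can be added to the union. Gains are measured by a finite measure with the same
  null sets, because \<open>M\<close> itself may be infinite.
\<close>

lemma (in sigma_finite_measure) maximal_set_mod_null:
  assumes sets: "\<And>A. Q A \<Longrightarrow> A \<in> sets M" and "Q A0"
    and union: "\<And>A :: nat \<Rightarrow> 'a set. incseq A \<Longrightarrow> (\<And>n. Q (A n)) \<Longrightarrow> Q (\<Union>n. A n)"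
  shows "\<exists>A. Q A \<and> (\<forall>B. Q B \<longrightarrow> A \<subseteq> B \<longrightarrow> emeasure M (B - A) = 0)"
proof -
  obtain h :: "'a \<Rightarrow> ennreal" where h[measurable]: "h \<in> borel_measurable M"
    and h_int: "integral\<^sup>N M h \<noteq> \<infinity>" and h_pos: "\<And>t. t \<in> space M \<Longrightarrow> 0 < h t"
    using Ex_finite_integrable_function by blast
  define M' where "M' = density M h"
  have sM': "sets M' = sets M" by (simp add: M'_def)
  interpret fin: finite_measure M'
  proof
    show "emeasure M' (space M') \<noteq> \<infinity>"
    proof -
      have "emeasure M' (space M') = (\<integral>\<^sup>+t. h t * indicator (space M) t \<partial>M)"
        unfolding M'_def by (subst emeasure_density) auto
      also have "\<dots> = integral\<^sup>N M h"
        by (rule nn_integral_cong) (auto simp: indicator_def)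
      finally show ?thesis using h_int by simp
    qed
  qed
  \<comment> \<open>\<open>s A\<close> is the largest size that can still be reached from \<open>A\<close>.\<close>
  define gain where "gain A B \<longleftrightarrow> Q B \<and> A \<subseteq> B" for A B
  define s where "s A = Sup (measure M' ` {B. gain A B})" for A
  have s_ub: "measure M' B \<le> s A" if "gain A B" for A B
    unfolding s_def using that fin.finite_measure_mono
    by (intro cSUP_upper) (auto intro!: bdd_aboveI[where M="measure M' (space M')"] fin.bounded_measure)
  have "\<exists>A. \<forall>n. Q (A n) \<and> (A n \<subseteq> A (Suc n) \<and> s (A n) \<le> measure M' (A (Suc n)) + 1 / Suc n)"
  proof (rule dependent_nat_choice)
    show "\<exists>A. Q A" using \<open>Q A0\<close> by blast
  next
    fix A n assume "Q A"
    then have ne: "measure M' ` {B. gain A B} \<noteq> {}" by (auto simp: gain_def)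
    have "s A - 1 / Suc n < s A" by simp
    then obtain B where "gain A B" "s A - 1 / Suc n < measure M' B"
      unfolding s_def using less_cSupE[OF _ ne, of "s A - 1 / Suc n"] by (auto simp: s_def)
    then show "\<exists>B. Q B \<and> (A \<subseteq> B \<and> s A \<le> measure M' B + 1 / Suc n)"
      by (intro exI[of _ B]) (auto simp: gain_def)
  qed
  then obtain A where Q: "\<And>n. Q (A n)" and sub: "\<And>n. A n \<subseteq> A (Suc n)"
    and approx: "\<And>n. s (A n) \<le> measure M' (A (Suc n)) + 1 / Suc n" by auto
  have inc: "incseq A" using sub by (rule incseq_SucI)
  let ?A = "\<Union>n. A n"
  have QA: "Q ?A" using inc Q by (rule union)
  have "emeasure M (B - ?A) = 0" if B: "Q B" "?A \<subseteq> B" for B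
  proof -
    have "measure M' B \<le> measure M' ?A + 1 / Suc n" for n
    proof -
      have "measure M' B \<le> s (A n)" using B by (intro s_ub) (auto simp: gain_def)
      also have "\<dots> \<le> measure M' (A (Suc n)) + 1 / Suc n" by (rule approx)
      also have "measure M' (A (Suc n)) \<le> measure M' ?A"
        using sets[OF QA] sM' by (intro fin.finite_measure_mono) auto
      finally show ?thesis by simp
    qed
    then have "measure M' B \<le> measure M' ?A"
      by (intro LIMSEQ_le_const[OF LIMSEQ_inverse_real_of_nat_add, of "measure M' B" "measure M' ?A"])
         (auto simp: inverse_eq_divide)
    then have "measure M' (B - ?A) = 0"
      using fin.finite_measure_Diff[of B ?A] sets[OF QA] sets[OF B(1)] B(2) sM'
        measure_nonneg[of M' "B - ?A"] by auto
    then have "B - ?A \<in> null_sets M'"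
      using sets[OF QA] sets[OF B(1)] sM' by (auto simp: fin.emeasure_eq_measure)
    then have "AE t in M. t \<in> B - ?A \<longrightarrow> h t = 0"
      unfolding M'_def using sets[OF QA] sets[OF B(1)] by (simp add: null_sets_density_iff)
    then have "AE t in M. t \<notin> B - ?A"
      using AE_space by eventually_elim (use h_pos in force)
    then show ?thesis
      using sets[OF QA] sets[OF B(1)] by (subst (asm) AE_iff_null_sets[symmetric]) (auto simp: null_sets_def)
  qed
  with QA show ?thesis by blast
qed

text \<open>
  Cut off a proper part of positive measure, keep the rest and repeat. The parts that are cut off are
  disjoint, so their indicators tend to \<open>0\<close> at every point; this replaces a
  decreasing sequence of sets whose measures tend to \<open>0\<close>.
\<close>

lemma nonatomic_disjoint_subsets:
  fixes M :: "'a measure"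
  assumes "nonatomic M" "A \<in> sets M" "0 < emeasure M A"
  shows "\<exists>D :: nat \<Rightarrow> 'a set. disjoint_family D \<and>
    (\<forall>i. D i \<in> sets M \<and> D i \<subseteq> A \<and> 0 < emeasure M (D i))"
proof -
  have "\<exists>R. \<forall>n. (R n \<in> sets M \<and> R n \<subseteq> A \<and> 0 < emeasure M (R n))
          \<and> (R (Suc n) \<subseteq> R n \<and> 0 < emeasure M (R n - R (Suc n)))"
  proof (rule dependent_nat_choice)
    show "\<exists>R. R \<in> sets M \<and> R \<subseteq> A \<and> 0 < emeasure M R" using assms by blast
  next
    fix R and n :: nat assume R: "R \<in> sets M \<and> R \<subseteq> A \<and> 0 < emeasure M R"
    then obtain B where B: "B \<in> sets M" "B \<subseteq> R" "0 < emeasure M B" "emeasure M B < emeasure M R"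
      using assms(1) unfolding nonatomic_def by blast
    then have "emeasure M (R - B) = emeasure M R - emeasure M B"
      using R by (intro emeasure_Diff) auto
    then have "0 < emeasure M (R - B)" using B by (simp add: diff_gr0_ennreal)
    then show "\<exists>B. (B \<in> sets M \<and> B \<subseteq> A \<and> 0 < emeasure M B) \<and> (B \<subseteq> R \<and> 0 < emeasure M (R - B))"
      using B R by blast
  qed
  then obtain R where R: "\<And>n. R n \<in> sets M" "\<And>n. R n \<subseteq> A"
    and sub: "\<And>n. R (Suc n) \<subseteq> R n" and pos: "\<And>n. 0 < emeasure M (R n - R (Suc n))" by metis
  have dec: "decseq R" using sub by (rule decseq_SucI)
  have disj: "(R m - R (Suc m)) \<inter> (R n - R (Suc n)) = {}" if "m < n" for m n
    using decseqD[OF dec, of "Suc m" n] that by auto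
  have "disjoint_family (\<lambda>n. R n - R (Suc n))"
    unfolding disjoint_family_on_def
  proof (intro ballI impI)
    fix m n :: nat assume "m \<noteq> n"
    then show "(R m - R (Suc m)) \<inter> (R n - R (Suc n)) = {}"
      using disj[of m n] disj[of n m] by (cases "m < n") auto
  qed
  with R pos show ?thesis by (intro exI[of _ "\<lambda>n. R n - R (Suc n)"]) auto
qed

section \<open>Ideal spaces with the Fatou property\<close>

text \<open>
  The modulus of concavity \<open>C\<close> of the quasi-norm is fixed once, since all the constants of the
  construction are expressed through it.
\<close>

locale Fatou_ideal_space = sigma_finite_measure M for M :: "'a measure" +
  fixes E :: "('a \<Rightarrow> real) set" and N :: "('a \<Rightarrow> real) \<Rightarrow> real" and C :: real
  assumes ideal_space: "quasi_Banach_ideal_space M E N" and Fatou: "Fatou_property M E N"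
    and C_ge_1: "1 \<le> C"
    and quasi_triangle: "\<And>x y. x \<in> E \<Longrightarrow> y \<in> E \<Longrightarrow> N (\<lambda>t. x t + y t) \<le> C * (N x + N y)"
begin

abbreviation set_norm :: "'a set \<Rightarrow> real" where
  "set_norm A \<equiv> N (indicat_real A)"

abbreviation Ea :: "('a \<Rightarrow> real) set" where
  "Ea \<equiv> order_continuous_part M E N"

lemma E_measurable: "x \<in> E \<Longrightarrow> x \<in> borel_measurable M"
  and zero_E: "(\<lambda>t. 0) \<in> E"
  and add_E: "x \<in> E \<Longrightarrow> y \<in> E \<Longrightarrow> (\<lambda>t. x t + y t) \<in> E"
  and scale_E: "x \<in> E \<Longrightarrow> (\<lambda>t. c * x t) \<in> E"
  using ideal_space unfolding quasi_Banach_ideal_space_def by auto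

lemma N_nonneg: "x \<in> E \<Longrightarrow> 0 \<le> N x"
  and N_eq_0_iff: "x \<in> E \<Longrightarrow> N x = 0 \<longleftrightarrow> (AE t in M. x t = 0)"
  and N_scale: "x \<in> E \<Longrightarrow> N (\<lambda>t. c * x t) = \<bar>c\<bar> * N x"
  using ideal_space unfolding quasi_Banach_ideal_space_def quasi_norm_on_def by auto

lemma
  assumes "y \<in> E" "x \<in> borel_measurable M" "AE t in M. \<bar>x t\<bar> \<le> \<bar>y t\<bar>"
  shows solid_E: "x \<in> E" and solid_N: "N x \<le> N y"
  using assms ideal_space unfolding quasi_Banach_ideal_space_def by auto

lemma N_zero: "N (\<lambda>t. 0) = 0"
  using N_eq_0_iff[OF zero_E] by simp

lemma
  fixes X :: "nat \<Rightarrow> 'a \<Rightarrow> real"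
  assumes "\<And>n. X n \<in> E" "x \<in> borel_measurable M" "\<And>n t. 0 \<le> X n t" "\<And>t. incseq (\<lambda>n. X n t)"
    and "AE t in M. (\<lambda>n. X n t) \<longlonglongrightarrow> x t" and bound: "\<And>n. N (X n) \<le> s"
  shows Fatou_E: "x \<in> E" and Fatou_N: "N x \<le> s"
proof -
  have "AE t in M. (\<forall>n. 0 \<le> X n t) \<and> incseq (\<lambda>n. X n t) \<and> (\<lambda>n. X n t) \<longlonglongrightarrow> \<bar>x t\<bar>"
    using assms(5)
  proof eventually_elim
    case (elim t)
    then have "0 \<le> x t" using assms(3) by (intro LIMSEQ_le_const) auto
    with elim assms(3,4) show ?case by auto
  qed
  moreover have "bdd_above (range (\<lambda>n. N (X n)))" using bound by (intro bdd_aboveI[of _ s]) auto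
  ultimately have *: "x \<in> E \<and> (\<lambda>n. N (X n)) \<longlonglongrightarrow> N x"
    using Fatou assms(1,2) unfolding Fatou_property_def by blast
  then show "x \<in> E" by blast
  show "N x \<le> s" using * bound by (intro LIMSEQ_le_const2) auto
qed

lemma
  assumes "A \<in> sets M" "B \<in> sets M" "indicat_real B \<in> E" "A \<subseteq> B"
  shows indicator_subset_E: "indicat_real A \<in> E" and set_norm_mono: "set_norm A \<le> set_norm B"
proof -
  have dom: "AE t in M. \<bar>indicat_real A t\<bar> \<le> \<bar>indicat_real B t\<bar>"
    using \<open>A \<subseteq> B\<close> by (auto simp: indicator_def)
  show "indicat_real A \<in> E" "set_norm A \<le> set_norm B"
    using assms(1) by (auto intro: solid_E[OF assms(3) _ dom] solid_N[OF assms(3) _ dom])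
qed

lemma
  fixes A :: "nat \<Rightarrow> 'a set"
  assumes "\<And>n. A n \<in> sets M" "\<And>n. indicat_real (A n) \<in> E" "incseq A"
    and R: "R \<in> sets M" "AE t in M. t \<in> R \<longleftrightarrow> t \<in> (\<Union>n. A n)" and bound: "\<And>n. set_norm (A n) \<le> s"
  shows incseq_indicator_E: "indicat_real R \<in> E" and incseq_set_norm_le: "set_norm R \<le> s"
proof -
  have lim: "AE t in M. (\<lambda>n. indicat_real (A n) t) \<longlonglongrightarrow> indicat_real R t"
    using R(2)
  proof eventually_elim
    case (elim t)
    have "(\<lambda>n. indicat_real (A n) t) \<longlonglongrightarrow> indicat_real (\<Union>n. A n) t"
      using \<open>incseq A\<close> by (rule LIMSEQ_indicator_incseq)
    then show ?case using elim by (simp add: indicator_def)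
  qed
  have mono: "incseq (\<lambda>n. indicat_real (A n) t)" for t
    using \<open>incseq A\<close> by (fastforce simp: incseq_def indicator_def)
  show "indicat_real R \<in> E" "set_norm R \<le> s"
    using R(1) by (auto intro: Fatou_E[OF assms(2) _ _ mono lim bound] Fatou_N[OF assms(2) _ _ mono lim bound])
qed

lemma
  assumes [measurable]: "A \<in> sets M" "B \<in> sets M" and E: "indicat_real A \<in> E" "indicat_real B \<in> E"
  shows indicator_Un_E: "indicat_real (A \<union> B) \<in> E"
    and set_norm_Un: "set_norm (A \<union> B) \<le> C * (set_norm A + set_norm B)"
proof -
  have dom: "AE t in M. \<bar>indicat_real (A \<union> B) t\<bar> \<le> \<bar>indicat_real A t + indicat_real B t\<bar>"
    by (auto simp: indicator_def)
  show "indicat_real (A \<union> B) \<in> E"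
    by (rule solid_E[OF add_E[OF E] _ dom]) measurable
  have "set_norm (A \<union> B) \<le> N (\<lambda>t. indicat_real A t + indicat_real B t)"
    by (rule solid_N[OF add_E[OF E] _ dom]) measurable
  also have "\<dots> \<le> C * (set_norm A + set_norm B)" using E by (rule quasi_triangle)
  finally show "set_norm (A \<union> B) \<le> C * (set_norm A + set_norm B)" .
qed

lemma set_norm_pos:
  assumes "A \<in> sets M" "indicat_real A \<in> E" "0 < emeasure M A"
  shows "0 < set_norm A"
proof -
  have "\<not> (AE t in M. indicat_real A t = 0)"
  proof
    assume "AE t in M. indicat_real A t = 0"
    then have "AE t in M. t \<notin> A" by eventually_elim (auto simp: indicator_def)
    then have "emeasure M A = 0" using assms(1)
      by (subst (asm) AE_iff_null_sets[symmetric]) (auto simp: null_sets_def)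
    then show False using assms(3) by simp
  qed
  then show ?thesis using N_nonneg[OF assms(2)] N_eq_0_iff[OF assms(2)] by linarith
qed

text \<open>
  Splitting off the first term each time, the $k$-th term passes through $k+1$ uses of the
  quasi-triangle inequality. Terms of quasi-norm at most $(2C)^{-(k+1)}$ therefore have partial sums
  bounded by $\sum 2^{-(k+1)} = 1$, and the Fatou property carries the bound over to the whole sum.
\<close>

lemma N_sum_le:
  "(\<And>k. f k \<in> E) \<Longrightarrow> (\<lambda>t. \<Sum>k<m. f k t) \<in> E \<and> N (\<lambda>t. \<Sum>k<m. f k t) \<le> (\<Sum>k<m. C ^ Suc k * N (f k))"
proof (induction m arbitrary: f)
  case 0
  then show ?case by (simp add: zero_E N_zero)
next
  case (Suc m)
  let ?g = "\<lambda>t. \<Sum>k<m. f (Suc k) t"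
  have g: "?g \<in> E" "N ?g \<le> (\<Sum>k<m. C ^ Suc k * N (f (Suc k)))"
    using Suc.IH[of "\<lambda>k. f (Suc k)"] Suc.prems by simp_all
  have "(\<lambda>t. f 0 t + ?g t) \<in> E" using Suc.prems g(1) by (rule add_E)
  moreover have "N (\<lambda>t. f 0 t + ?g t) \<le> C * (N (f 0) + (\<Sum>k<m. C ^ Suc k * N (f (Suc k))))"
    using quasi_triangle[OF Suc.prems g(1), of 0] g(2) C_ge_1
    by (smt (verit, best) mult_left_mono)
  ultimately show ?case
    by (simp add: sum.lessThan_Suc_shift sum_distrib_left algebra_simps del: sum.lessThan_Suc)
qed

lemma
  assumes f: "\<And>k. f k \<in> E" "\<And>k t. 0 \<le> f k t" "\<And>k. N (f k) \<le> (1 / (2 * C)) ^ Suc k"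
    and x: "x \<in> borel_measurable M" "AE t in M. (\<lambda>k. f k t) sums x t"
  shows geometric_sum_E: "x \<in> E" and geometric_sum_N_le_1: "N x \<le> 1"
proof -
  have partial: "(\<lambda>t. \<Sum>k<m. f k t) \<in> E"
    "N (\<lambda>t. \<Sum>k<m. f k t) \<le> (\<Sum>k<m. C ^ Suc k * N (f k))" for m
    using N_sum_le[of f m] f(1) by simp_all
  have bound: "N (\<lambda>t. \<Sum>k<m. f k t) \<le> 1" for m
  proof -
    have "N (\<lambda>t. \<Sum>k<m. f k t) \<le> (\<Sum>k<m. C ^ Suc k * N (f k))"
      by (rule partial(2))
    also have "\<dots> \<le> (\<Sum>k<m. (1/2) ^ Suc k)"
    proof (intro sum_mono)
      fix k
      have "C ^ Suc k * N (f k) \<le> C ^ Suc k * (1 / (2 * C)) ^ Suc k"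
        using f(3) C_ge_1 by (intro mult_left_mono) auto
      also have "\<dots> = (1/2) ^ Suc k"
        using C_ge_1 by (simp only: power_mult_distrib[symmetric]) simp
      finally show "C ^ Suc k * N (f k) \<le> (1/2) ^ Suc k" .
    qed
    also have "\<dots> \<le> (\<Sum>k. (1/2::real) ^ Suc k)"
      using power_half_series by (intro sum_le_suminf) (auto simp: sums_iff)
    also have "\<dots> = 1" using power_half_series by (simp add: sums_iff)
    finally show ?thesis .
  qed
  have inc: "incseq (\<lambda>m. \<Sum>k<m. f k t)" for t
    using f(2) by (intro incseq_SucI) simp
  have nonneg: "0 \<le> (\<Sum>k<m. f k t)" for m t using f(2) by (intro sum_nonneg) auto
  note lim = x(2)[unfolded sums_def]
  show "x \<in> E" by (rule Fatou_E[OF partial(1) x(1) nonneg inc lim bound])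
  show "N x \<le> 1" by (rule Fatou_N[OF partial(1) x(1) nonneg inc lim bound])
qed

section \<open>The order continuous part\<close>

lemma indicator_empty_fun: "indicat_real {} = (\<lambda>t. 0)"
  by (rule ext) simp

lemma Ea_E: "x \<in> Ea \<Longrightarrow> x \<in> E"
  by (simp add: order_continuous_part_def)

lemma Ea_tendsto_0:
  fixes X :: "nat \<Rightarrow> 'a \<Rightarrow> real"
  assumes "x \<in> Ea" "\<And>n. X n \<in> borel_measurable M" "\<And>n. AE t in M. 0 \<le> X n t \<and> X n t \<le> \<bar>x t\<bar>"
    "AE t in M. (\<lambda>n. X n t) \<longlonglongrightarrow> 0"
  shows "(\<lambda>n. N (X n)) \<longlonglongrightarrow> 0"
proof -
  have "range X \<subseteq> borel_measurable M" using assms(2) by auto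
  then show ?thesis using assms(1,3,4) unfolding order_continuous_part_def by blast
qed

lemma Ea_I:
  assumes "x \<in> E"
    and "\<And>X :: nat \<Rightarrow> 'a \<Rightarrow> real. (\<And>n. X n \<in> borel_measurable M) \<Longrightarrow>
      (\<And>n. AE t in M. 0 \<le> X n t \<and> X n t \<le> \<bar>x t\<bar>) \<Longrightarrow> AE t in M. (\<lambda>n. X n t) \<longlonglongrightarrow> 0 \<Longrightarrow>
      (\<lambda>n. N (X n)) \<longlonglongrightarrow> 0"
  shows "x \<in> Ea"
  unfolding order_continuous_part_def using assms by (auto simp: image_subset_iff)

lemma zero_Ea: "(\<lambda>t. 0) \<in> Ea"
proof (rule Ea_I[OF zero_E])
  fix X :: "nat \<Rightarrow> 'a \<Rightarrow> real"
  assume X: "\<And>n. X n \<in> borel_measurable M" "\<And>n. AE t in M. 0 \<le> X n t \<and> X n t \<le> \<bar>0\<bar>"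
  have "N (X n) = 0" for n
  proof -
    have ae: "AE t in M. X n t = 0" using X(2)[of n] by eventually_elim auto
    then have "AE t in M. \<bar>X n t\<bar> \<le> \<bar>0\<bar>" by eventually_elim simp
    then have "X n \<in> E" by (rule solid_E[OF zero_E X(1)])
    then show ?thesis using ae N_eq_0_iff by blast
  qed
  then show "(\<lambda>n. N (X n)) \<longlonglongrightarrow> 0" by simp
qed

lemma Ea_dominated:
  assumes x: "x \<in> Ea" and y: "y \<in> borel_measurable M" and c: "0 < c"
    and dom: "AE t in M. c * \<bar>y t\<bar> \<le> \<bar>x t\<bar>"
  shows "y \<in> Ea"
proof (rule Ea_I)
  have "AE t in M. \<bar>y t\<bar> \<le> \<bar>(1 / c) * x t\<bar>"
    using dom by eventually_elim (use c in \<open>simp add: abs_mult field_simps\<close>)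
  with y show yE: "y \<in> E" by (rule solid_E[OF scale_E[OF Ea_E[OF x]]])
  fix X :: "nat \<Rightarrow> 'a \<Rightarrow> real"
  assume X: "\<And>n. X n \<in> borel_measurable M" "\<And>n. AE t in M. 0 \<le> X n t \<and> X n t \<le> \<bar>y t\<bar>"
    and lim: "AE t in M. (\<lambda>n. X n t) \<longlonglongrightarrow> 0"
  have XE: "X n \<in> E" for n
  proof (rule solid_E[OF yE X(1)])
    show "AE t in M. \<bar>X n t\<bar> \<le> \<bar>y t\<bar>" using X(2)[of n] by eventually_elim simp
  qed
  have "(\<lambda>n. N (\<lambda>t. c * X n t)) \<longlonglongrightarrow> 0"
  proof (rule Ea_tendsto_0[OF x])
    show "(\<lambda>t. c * X n t) \<in> borel_measurable M" for n using X(1)[of n] by measurable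
    show "AE t in M. 0 \<le> c * X n t \<and> c * X n t \<le> \<bar>x t\<bar>" for n
      using X(2)[of n] dom
    proof eventually_elim
      case (elim t)
      have "c * X n t \<le> c * \<bar>y t\<bar>" using elim c by (intro mult_left_mono) auto
      also have "\<dots> \<le> \<bar>x t\<bar>" using elim by simp
      finally show ?case using elim c by simp
    qed
    show "AE t in M. (\<lambda>n. c * X n t) \<longlonglongrightarrow> 0"
      using lim by eventually_elim (rule tendsto_mult_right_zero)
  qed
  then have "(\<lambda>n. c * N (X n)) \<longlonglongrightarrow> 0" using c by (simp add: N_scale[OF XE])
  then have "(\<lambda>n. (1 / c) * (c * N (X n))) \<longlonglongrightarrow> 0" by (rule tendsto_mult_right_zero)
  then show "(\<lambda>n. N (X n)) \<longlonglongrightarrow> 0" using c by simp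
qed

lemma indicator_subset_Ea:
  assumes "indicat_real B \<in> Ea" "A \<in> sets M" "A \<subseteq> B"
  shows "indicat_real A \<in> Ea"
  by (rule Ea_dominated[OF assms(1), of _ 1]) (use assms in \<open>auto simp: indicator_def\<close>)

lemma indicator_Un_Ea:
  assumes A: "indicat_real A \<in> Ea" "A \<in> sets M" and B: "indicat_real B \<in> Ea" "B \<in> sets M"
  shows "indicat_real (A \<union> B) \<in> Ea"
proof (rule Ea_I)
  show ABE: "indicat_real (A \<union> B) \<in> E"
    using A B by (intro indicator_Un_E) (auto intro: Ea_E)
  fix X :: "nat \<Rightarrow> 'a \<Rightarrow> real"
  assume X[measurable]: "\<And>n. X n \<in> borel_measurable M"
    and dom: "\<And>n. AE t in M. 0 \<le> X n t \<and> X n t \<le> \<bar>indicat_real (A \<union> B) t\<bar>"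
    and lim: "AE t in M. (\<lambda>n. X n t) \<longlonglongrightarrow> 0"
  have piece: "(\<lambda>n. N (\<lambda>t. X n t * indicat_real D t)) \<longlonglongrightarrow> 0"
      "\<And>n. (\<lambda>t. X n t * indicat_real D t) \<in> E"
    if D: "indicat_real D \<in> Ea" and [measurable]: "D \<in> sets M" for D
  proof -
    have *: "AE t in M. 0 \<le> X n t * indicat_real D t \<and> X n t * indicat_real D t \<le> \<bar>indicat_real D t\<bar>" for n
      using dom[of n]
    proof eventually_elim
      case (elim t)
      have "\<bar>indicat_real (A \<union> B) t\<bar> \<le> 1" by (simp add: indicator_def)
      with elim have "0 \<le> X n t" "X n t \<le> 1" by (blast intro: order_trans)+
      then show ?case by (simp add: indicator_def)
    qed
    show "(\<lambda>n. N (\<lambda>t. X n t * indicat_real D t)) \<longlonglongrightarrow> 0"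
    proof (rule Ea_tendsto_0[OF D _ *])
      show "AE t in M. (\<lambda>n. X n t * indicat_real D t) \<longlonglongrightarrow> 0"
        using lim by eventually_elim (rule tendsto_mult_left_zero)
    qed measurable
    show "(\<lambda>t. X n t * indicat_real D t) \<in> E" for n
    proof (rule solid_E[OF Ea_E[OF D]])
      show "AE t in M. \<bar>X n t * indicat_real D t\<bar> \<le> \<bar>indicat_real D t\<bar>"
        using *[of n] by eventually_elim simp
    qed measurable
  qed
  have XE: "X n \<in> E" for n
  proof (rule solid_E[OF ABE X])
    show "AE t in M. \<bar>X n t\<bar> \<le> \<bar>indicat_real (A \<union> B) t\<bar>"
      using dom[of n] by eventually_elim simp
  qed
  have upper: "N (X n) \<le> C * (N (\<lambda>t. X n t * indicat_real A t) + N (\<lambda>t. X n t * indicat_real B t))" for n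
  proof -
    note E2 = piece(2)[OF A, of n] piece(2)[OF B, of n]
    have "N (X n) \<le> N (\<lambda>t. X n t * indicat_real A t + X n t * indicat_real B t)"
    proof (rule solid_N[OF add_E[OF E2] X])
      show "AE t in M. \<bar>X n t\<bar> \<le> \<bar>X n t * indicat_real A t + X n t * indicat_real B t\<bar>"
        using dom[of n] by eventually_elim (auto simp: indicator_def split: if_splits)
    qed
    also have "\<dots> \<le> C * (N (\<lambda>t. X n t * indicat_real A t) + N (\<lambda>t. X n t * indicat_real B t))"
      by (rule quasi_triangle[OF E2])
    finally show ?thesis .
  qed
  have lim': "(\<lambda>n. C * (N (\<lambda>t. X n t * indicat_real A t) + N (\<lambda>t. X n t * indicat_real B t))) \<longlonglongrightarrow> 0"
    using tendsto_mult_right_zero[OF tendsto_add[OF piece(1)[OF A] piece(1)[OF B], simplified]] by simp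
  show "(\<lambda>n. N (X n)) \<longlonglongrightarrow> 0"
  proof (rule tendsto_sandwich[OF _ _ tendsto_const lim'])
    show "\<forall>\<^sub>F n in sequentially. 0 \<le> N (X n)"
      by (intro always_eventually allI N_nonneg XE)
    show "\<forall>\<^sub>F n in sequentially.
        N (X n) \<le> C * (N (\<lambda>t. X n t * indicat_real A t) + N (\<lambda>t. X n t * indicat_real B t))"
      by (intro always_eventually allI upper)
  qed
qed

text \<open>
  The sets $\{|x| \ge 1/(n+1)\}$ exhaust $\{x \ne 0\}$, so one of them meets \<open>D\<close> in positive measure,
  and there \<open>|x|\<close> dominates a multiple of the indicator.
\<close>

lemma Ea_nonzero_indicator:
  assumes x: "x \<in> Ea" and D[measurable]: "D \<in> sets M" and nz: "\<not> (AE t in M. t \<in> D \<longrightarrow> x t = 0)"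
  obtains B where "B \<in> sets M" "B \<subseteq> D" "indicat_real B \<in> Ea" "0 < emeasure M B"
proof -
  have [measurable]: "x \<in> borel_measurable M" using x by (intro E_measurable Ea_E)
  define B where "B n = {t \<in> space M. t \<in> D \<and> 1 / Suc n \<le> \<bar>x t\<bar>}" for n :: nat
  have B[measurable]: "B n \<in> sets M" for n unfolding B_def by measurable
  have "\<exists>n. 0 < emeasure M (B n)"
  proof (rule ccontr)
    assume "\<nexists>n. 0 < emeasure M (B n)"
    then have "B n \<in> null_sets M" for n using B by (auto simp: null_sets_def)
    then have "AE t in M. \<forall>n. t \<notin> B n" by (simp add: AE_all_countable AE_not_in)
    then have "AE t in M. t \<in> D \<longrightarrow> x t = 0"
      using AE_space
    proof eventually_elim
      case (elim t)
      show ?case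
      proof (intro impI, rule ccontr)
        assume "t \<in> D" "x t \<noteq> 0"
        then obtain n where "1 / Suc n < \<bar>x t\<bar>" using nat_approx_posE[of "\<bar>x t\<bar>"] by auto
        moreover have "t \<notin> B n" using elim by blast
        ultimately show False using elim \<open>t \<in> D\<close> by (simp add: B_def)
      qed
    qed
    with nz show False by blast
  qed
  then obtain n where n: "0 < emeasure M (B n)" by blast
  have "indicat_real (B n) \<in> Ea"
    by (rule Ea_dominated[OF x, of _ "1 / Suc n"]) (auto simp: B_def indicator_def)
  with n show ?thesis by (intro that[of "B n"]) (auto simp: B_def)
qed

text \<open>
  A substitute for the intermediate value theorem, which fails for \<open>set_norm\<close> because a quasi-norm
  need not be continuous. Take a maximal \<open>A \<subseteq> R\<close> with \<open>set_norm A \<le> s\<close>, which exists because the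
  Fatou property bounds increasing unions. By order continuity the rest of \<open>R\<close> contains sets \<open>D\<close> of
  positive measure with arbitrarily small \<open>set_norm D\<close>. Adding one to \<open>A\<close> must exceed \<open>s\<close>, and the
  quasi-triangle inequality turns this into a lower bound for \<open>set_norm A\<close>.
\<close>

lemma set_norm_intermediate:
  assumes atomless: "nonatomic M" and R[measurable]: "R \<in> sets M" and REa: "indicat_real R \<in> Ea"
    and s: "0 < s" "s < set_norm R"
  obtains A where "A \<in> sets M" "A \<subseteq> R" "s / (2 * C) \<le> set_norm A" "set_norm A \<le> s"
proof -
  define Q where "Q A \<longleftrightarrow> A \<in> sets M \<and> A \<subseteq> R \<and> set_norm A \<le> s" for A
  have RE: "indicat_real R \<in> E" using REa by (rule Ea_E)
  have subE: "indicat_real A \<in> E" if "A \<in> sets M" "A \<subseteq> R" for A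
    using that by (intro indicator_subset_E[OF _ R RE])
  have "set_norm {} = 0" using N_zero by (simp add: indicator_empty_fun)
  then have Q_empty: "Q {}" using s by (simp add: Q_def)
  have Q_sets: "A \<in> sets M" if "Q A" for A using that by (simp add: Q_def)
  have Q_union: "Q (\<Union>n. A n)" if "incseq A" "\<And>n. Q (A n)" for A :: "nat \<Rightarrow> 'a set"
  proof -
    have *: "\<And>n. A n \<in> sets M" "\<And>n. indicat_real (A n) \<in> E" "\<And>n. set_norm (A n) \<le> s"
      using that(2) subE by (auto simp: Q_def)
    then have "set_norm (\<Union>n. A n) \<le> s"
      by (intro incseq_set_norm_le[OF *(1,2) that(1) _ _ *(3)]) auto
    moreover have "(\<Union>n. A n) \<subseteq> R" using that(2) by (intro UN_least) (simp add: Q_def)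
    ultimately show ?thesis using *(1) by (auto simp: Q_def)
  qed
  obtain A where QA: "Q A" and max: "\<And>B. Q B \<Longrightarrow> A \<subseteq> B \<Longrightarrow> emeasure M (B - A) = 0"
    using maximal_set_mod_null[OF Q_sets Q_empty Q_union] by blast
  have A[measurable]: "A \<in> sets M" and AR: "A \<subseteq> R" and As: "set_norm A \<le> s"
    using QA by (auto simp: Q_def)
  have "0 < emeasure M (R - A)"
  proof (rule ccontr)
    assume "\<not> 0 < emeasure M (R - A)"
    then have "R - A \<in> null_sets M" by (auto simp: null_sets_def)
    from AE_not_in[OF this] have "AE t in M. \<bar>indicat_real R t\<bar> \<le> \<bar>indicat_real A t\<bar>"
      by eventually_elim (auto simp: indicator_def)
    then have "set_norm R \<le> set_norm A" by (intro solid_N[OF subE[OF A AR] borel_measurable_indicator[OF R]])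
    with As s show False by simp
  qed
  then obtain D :: "nat \<Rightarrow> 'a set" where D_disj: "disjoint_family D"
    and D_all: "\<forall>i. D i \<in> sets M \<and> D i \<subseteq> R - A \<and> 0 < emeasure M (D i)"
    using nonatomic_disjoint_subsets[OF atomless sets.Diff[OF R A]] by blast
  have D: "disjoint_family D" "D i \<in> sets M" "D i \<subseteq> R - A" "0 < emeasure M (D i)" for i
    using D_disj D_all by auto
  have "(\<lambda>i. set_norm (D i)) \<longlonglongrightarrow> 0"
  proof (rule Ea_tendsto_0[OF REa])
    show "AE t in M. 0 \<le> indicat_real (D n) t \<and> indicat_real (D n) t \<le> \<bar>indicat_real R t\<bar>" for n
      using D(3)[of n] by (auto simp: indicator_def)
    show "AE t in M. (\<lambda>n. indicat_real (D n) t) \<longlonglongrightarrow> 0"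
    proof (rule AE_I2)
      fix t
      have "\<exists>i. \<forall>n>i. t \<notin> D n"
      proof (cases "\<exists>i. t \<in> D i")
        case True
        then obtain i where "t \<in> D i" by blast
        moreover have "D i \<inter> D n = {}" if "i < n" for n
          using that D_disj by (simp add: disjoint_family_on_def)
        ultimately have "\<forall>n>i. t \<notin> D n" by blast
        then show ?thesis by blast
      qed auto
      then obtain i where "\<forall>n>i. t \<notin> D n" by blast
      then have "eventually (\<lambda>n. indicat_real (D n) t = 0) sequentially"
        unfolding eventually_sequentially by (intro exI[of _ "Suc i"]) (auto simp: indicator_def Suc_le_eq)
      then show "(\<lambda>n. indicat_real (D n) t) \<longlonglongrightarrow> 0" by (rule tendsto_eventually)
    qed
  qed (use D(2) in measurable)
  then have "eventually (\<lambda>i. set_norm (D i) < s / (2 * C)) sequentially"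
    using s C_ge_1 by (intro order_tendstoD) auto
  then obtain i where i: "set_norm (D i) < s / (2 * C)"
    by (auto simp: eventually_sequentially)
  have DR: "D i \<subseteq> R" using D(3) by blast
  have "\<not> Q (A \<union> D i)"
  proof
    assume "Q (A \<union> D i)"
    then have "emeasure M (A \<union> D i - A) = 0" by (intro max) auto
    moreover have "A \<union> D i - A = D i" using D(3) by blast
    ultimately show False using D(4)[of i] by simp
  qed
  then have "s < set_norm (A \<union> D i)" using A AR DR D(2)[of i] by (auto simp: Q_def)
  also have "\<dots> \<le> C * (set_norm A + set_norm (D i))"
    using A AR DR D(2) by (intro set_norm_Un subE) auto
  also have "\<dots> \<le> C * (set_norm A + s / (2 * C))"
    using i C_ge_1 by (intro mult_left_mono) auto
  also have "\<dots> = C * set_norm A + s / 2" using C_ge_1 by (simp add: field_simps)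
  finally have "s / (2 * C) \<le> set_norm A" using C_ge_1 by (simp add: field_simps)
  with A AR As show ?thesis by (intro that)
qed

text \<open>
  Full support of \<open>Ea\<close> makes \<open>R\<close>, up to a null set, a countable union of sets with indicator in \<open>Ea\<close>:
  a maximal such union leaves no room for a further set from \<open>Ea_nonzero_indicator\<close>. If the finite
  partial unions had bounded \<open>set_norm\<close>, the Fatou property would put the indicator of \<open>R\<close> into \<open>E\<close>.
\<close>

lemma Ea_large_subset:
  assumes supp: "is_support M Ea (space M)" and R[measurable]: "R \<in> sets M" and RE: "indicat_real R \<notin> E"
  obtains B where "B \<in> sets M" "B \<subseteq> R" "indicat_real B \<in> Ea" "s < set_norm B"
proof -
  define I where "I = {B \<in> sets M. B \<subseteq> R \<and> indicat_real B \<in> Ea}"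
  define Q where "Q A \<longleftrightarrow> (\<exists>\<G>. countable \<G> \<and> \<G> \<subseteq> I \<and> A = \<Union>\<G>)" for A
  have empty_I: "{} \<in> I" using zero_Ea by (simp add: I_def indicator_empty_fun)
  have Q_countable: "Q (\<Union>\<G>)" if "countable \<G>" "\<G> \<subseteq> I" for \<G>
    using that unfolding Q_def by blast
  have Q_sets: "A \<in> sets M" "A \<subseteq> R" if QA: "Q A" for A
  proof -
    obtain \<G> where \<G>: "countable \<G>" "\<G> \<subseteq> I" "A = \<Union>\<G>" using QA unfolding Q_def by blast
    then show "A \<in> sets M" by (auto simp: I_def intro!: sets.countable_Union)
    show "A \<subseteq> R" using \<G> unfolding I_def by blast
  qed
  have Q_empty: "Q {}" using Q_countable[of "{}"] by simp
  have Q_union: "Q (\<Union>n. A n)" if "incseq A" and AQ: "\<And>n. Q (A n)" for A :: "nat \<Rightarrow> 'a set"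
  proof -
    obtain \<G> where \<G>: "\<And>n. countable (\<G> n)" "\<And>n. \<G> n \<subseteq> I" "\<And>n. A n = \<Union>(\<G> n)"
      using AQ unfolding Q_def by metis
    have "(\<Union>n. A n) = \<Union>(\<Union>n. \<G> n)" unfolding \<G>(3) by blast
    moreover have "Q (\<Union>(\<Union>n. \<G> n))" using \<G>(1,2) by (intro Q_countable countable_UN) auto
    ultimately show ?thesis by simp
  qed
  obtain A where QA: "Q A" and max: "\<And>B. Q B \<Longrightarrow> A \<subseteq> B \<Longrightarrow> emeasure M (B - A) = 0"
    using maximal_set_mod_null[OF Q_sets(1) Q_empty Q_union] by blast
  obtain \<G> where \<G>: "countable \<G>" "\<G> \<subseteq> I" "A = \<Union>\<G>" using QA unfolding Q_def by blast
  \<comment> \<open>The empty set is added because \<open>\<G>\<close> may be empty, while an enumeration has nonempty range.\<close>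
  define G where "G = from_nat_into (insert {} \<G>)"
  have "range G = insert {} \<G>" using \<G>(1) unfolding G_def by (intro range_from_nat_into) auto
  then have G: "range G \<subseteq> I" "A = (\<Union>n. G n)" using \<G> empty_I by simp_all
  have A[measurable]: "A \<in> sets M" and AR: "A \<subseteq> R" using Q_sets[OF QA] .
  have null: "R - A \<in> null_sets M"
  proof (rule ccontr)
    assume "R - A \<notin> null_sets M"
    then have not_null: "\<not> (AE t in M. t \<notin> R - A)"
      using AE_iff_null_sets[OF sets.Diff[OF R A]] by blast
    have "\<not> (AE t in M. t \<in> space M \<longrightarrow> t \<in> space M - (R - A))"
    proof
      assume "AE t in M. t \<in> space M \<longrightarrow> t \<in> space M - (R - A)"
      then have "AE t in M. t \<notin> R - A" using AE_space by eventually_elim auto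
      with not_null show False by blast
    qed
    moreover have "space M - (R - A) \<in> sets M" by measurable
    ultimately obtain x where x: "x \<in> Ea" "\<not> (AE t in M. t \<notin> space M - (R - A) \<longrightarrow> x t = 0)"
      using supp unfolding is_support_def by blast
    have nz: "\<not> (AE t in M. t \<in> R - A \<longrightarrow> x t = 0)"
    proof
      assume "AE t in M. t \<in> R - A \<longrightarrow> x t = 0"
      then have "AE t in M. t \<notin> space M - (R - A) \<longrightarrow> x t = 0"
        using AE_space by eventually_elim auto
      with x(2) show False by blast
    qed
    obtain B where B: "B \<in> sets M" "B \<subseteq> R - A" "indicat_real B \<in> Ea" "0 < emeasure M B"
      by (rule Ea_nonzero_indicator[OF x(1) sets.Diff[OF R A] nz])
    have "Q (\<Union>(insert B (range G)))" using B G(1) by (intro Q_countable) (auto simp: I_def)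
    then have "emeasure M (\<Union>(insert B (range G)) - A) = 0" using G(2) by (intro max) auto
    moreover have "\<Union>(insert B (range G)) - A = B" using B(2) G(2) by auto
    ultimately show False using B(4) by simp
  qed
  define H where "H n = (\<Union>i<n. G i)" for n
  have H: "H n \<in> I" for n
  proof (induction n)
    case (Suc n)
    have "H (Suc n) = H n \<union> G n" by (auto simp: H_def less_Suc_eq)
    then show ?case using Suc G(1) by (auto simp: I_def image_subset_iff intro!: indicator_Un_Ea)
  qed (simp add: H_def empty_I)
  have "\<exists>n. s < set_norm (H n)"
  proof (rule ccontr)
    assume "\<nexists>n. s < set_norm (H n)"
    then have bound: "\<And>n. set_norm (H n) \<le> s" by (simp add: not_less)
    have UN: "(\<Union>n. H n) = A" unfolding G(2) H_def by auto
    have ae: "AE t in M. t \<in> R \<longleftrightarrow> t \<in> (\<Union>n. H n)"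
      using AE_not_in[OF null] unfolding UN by eventually_elim (use AR in auto)
    have "indicat_real R \<in> E"
    proof (rule incseq_indicator_E[OF _ _ _ R ae bound])
      show "H n \<in> sets M" "indicat_real (H n) \<in> E" for n using H[of n] Ea_E by (auto simp: I_def)
      show "incseq H" unfolding H_def by (intro incseq_SucI UN_mono) auto
    qed
    with RE show False by blast
  qed
  then obtain n where "s < set_norm (H n)" by blast
  with H[of n] show ?thesis by (intro that[of "H n"]) (auto simp: I_def)
qed

end

section \<open>Failure of the doubling conditions at every dilation\<close>

lemma Orlicz_function_mono: "Orlicz_function \<phi> \<Longrightarrow> 0 \<le> u \<Longrightarrow> u \<le> v \<Longrightarrow> \<phi> u \<le> \<phi> v"
  unfolding Orlicz_function_def mono_on_def by auto

lemma Orlicz_function_0: "Orlicz_function \<phi> \<Longrightarrow> \<phi> 0 = 0"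
  by (simp add: Orlicz_function_def)

text \<open>
  If one dilation by \<open>l > 1\<close> costs a factor \<open>K\<close>, then \<open>m\<close> of them cost \<open>K ^ m\<close>, and \<open>l ^ m\<close> exceeds \<open>2\<close>.
  Hence failure of a doubling condition means failure for dilations arbitrarily close to \<open>1\<close>. This
  is what makes the copy isometric instead of merely isomorphic.
\<close>

lemma doubling_of_dilation:
  assumes \<phi>: "Orlicz_function \<phi>" and l: "1 < l" and K: "1 \<le> K" and u0: "0 \<le> u0"
    and dil: "\<And>u. u0 \<le> u \<Longrightarrow> \<phi> (l * u) \<le> ennreal K * \<phi> u"
  shows "\<exists>K'>0. \<forall>u\<ge>u0. \<phi> (2 * u) \<le> ennreal K' * \<phi> u"
proof -
  have iter: "\<phi> (l ^ m * u) \<le> ennreal (K ^ m) * \<phi> u" if "u0 \<le> u" for m u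
  proof (induction m)
    case (Suc m)
    have "1 \<le> l ^ m" using l by (intro one_le_power) simp
    then have "1 * u \<le> l ^ m * u" using that u0 by (intro mult_right_mono) auto
    then have "\<phi> (l * (l ^ m * u)) \<le> ennreal K * \<phi> (l ^ m * u)" using that by (intro dil) simp
    also have "\<dots> \<le> ennreal K * (ennreal (K ^ m) * \<phi> u)" using Suc by (rule mult_left_mono) simp
    also have "\<dots> = ennreal (K ^ Suc m) * \<phi> u" using K by (simp add: ennreal_mult mult.assoc)
    finally show ?case by (simp add: mult.assoc)
  qed simp
  obtain m where m: "2 < l ^ m" using real_arch_pow[OF l] by blast
  have "\<phi> (2 * u) \<le> ennreal (K ^ m) * \<phi> u" if u: "u0 \<le> u" for u
  proof -
    have "\<phi> (2 * u) \<le> \<phi> (l ^ m * u)"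
      using m u u0 by (intro Orlicz_function_mono[OF \<phi>] mult_right_mono) auto
    with iter[OF u, of m] show ?thesis by simp
  qed
  moreover have "0 < K ^ m" using K by simp
  ultimately show ?thesis by blast
qed

lemma not_Delta2_Rplus_dilation:
  assumes \<phi>: "Orlicz_function \<phi>" and "\<not> Delta2_Rplus \<phi>" and l: "1 < l" and K: "0 < K"
  obtains u where "0 \<le> u" "\<phi> u < \<infinity>" "ennreal K * \<phi> u < \<phi> (l * u)"
proof -
  have "\<not> (\<forall>u\<ge>0. \<phi> (l * u) \<le> ennreal (max 1 K) * \<phi> u)"
    using doubling_of_dilation[OF \<phi> l, of "max 1 K" 0] assms(2) by (auto simp: Delta2_Rplus_def)
  then obtain u where u: "0 \<le> u" "ennreal (max 1 K) * \<phi> u < \<phi> (l * u)" by (auto simp: not_le)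
  have "ennreal K * \<phi> u \<le> ennreal (max 1 K) * \<phi> u"
    by (intro mult_right_mono ennreal_leI) auto
  also note u(2)
  finally have "ennreal K * \<phi> u < \<phi> (l * u)" .
  moreover have "\<phi> u < \<infinity>"
    using u(2) by (auto simp: less_top[symmetric] ennreal_mult_eq_top_iff top_unique)
  ultimately show ?thesis using u(1) that by blast
qed

text \<open>
  If \<open>\<phi>\<close> takes the value \<open>\<infinity>\<close>, dilation across its finite and positive threshold \<open>b_param \<phi>\<close> gives
  an infinite value at \<open>l * u\<close>. Otherwise the doubling condition fails beyond every \<open>u0\<close>, in
  particular beyond one where \<open>\<phi>\<close> already exceeds \<open>c\<close>. The last alternative is what later makes a set
  of limited size big enough to carry a block.
\<close>

lemma not_Delta2_infty_dilation:
  assumes \<phi>: "Orlicz_function \<phi>" and ab: "a_param \<phi> < b_param \<phi>"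
    and nd: "\<not> Delta2_infty \<phi>" and l: "1 < l" and K: "0 < K"
  obtains u where "0 \<le> u" "\<phi> u < \<infinity>" "ennreal K * \<phi> u < \<phi> (l * u)"
    "\<phi> (l * u) = \<infinity> \<or> ennreal c \<le> \<phi> u"
proof (cases "\<exists>v\<ge>0. \<phi> v = \<infinity>")
  case True
  then obtain v where v: "0 \<le> v" "\<phi> v = \<infinity>" by blast
  define S where "S = {u. 0 \<le> u \<and> \<phi> u < \<infinity>}"
  have fin_le: "u \<le> v" if "u \<in> S" for u
    using that v Orlicz_function_mono[OF \<phi>, of v u] by (force simp: S_def top_unique)
  have bdd: "bdd_above S" using fin_le by (rule bdd_aboveI)
  have "0 \<le> a_param \<phi>"
    unfolding a_param_def using Orlicz_function_0[OF \<phi>] by (intro Sup_upper) (auto simp: zero_ereal_def)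
  then have "0 < b_param \<phi>" using ab by simp
  then obtain w where w: "w \<in> S" "0 < w"
    unfolding b_param_def S_def by (auto simp: less_Sup_iff)
  have "0 < Sup S" using w cSup_upper[OF w(1) bdd] by simp
  then have "Sup S / l < Sup S" using l by (simp add: field_simps)
  then obtain u where u: "u \<in> S" "Sup S / l < u"
    using less_cSupE[of "Sup S / l" S] w(1) by blast
  have "Sup S < l * u" using u(2) l by (simp add: field_simps)
  then have "l * u \<notin> S" using cSup_upper[OF _ bdd, of "l * u"] by auto
  moreover have "0 \<le> l * u" using u l by (auto simp: S_def)
  ultimately have inf: "\<phi> (l * u) = \<infinity>" by (auto simp: S_def less_top[symmetric])
  moreover have "ennreal K * \<phi> u < \<infinity>"
    using u(1) by (auto simp: S_def ennreal_mult_less_top)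
  ultimately show ?thesis using u(1) that[of u] by (auto simp: S_def)
next
  case False
  then have fin: "\<phi> v < \<infinity>" if "0 \<le> v" for v using that by (auto simp: less_top)
  have "(\<phi> \<longlongrightarrow> \<infinity>) at_top" using \<phi> by (simp add: Orlicz_function_def)
  then have "eventually (\<lambda>u. ennreal c < \<phi> u) at_top" by (rule order_tendstoD) simp
  then have "eventually (\<lambda>u. ennreal c < \<phi> u \<and> 0 < u) at_top"
    using eventually_gt_at_top by (rule eventually_conj)
  then obtain u0 where u0: "ennreal c < \<phi> u0" "0 < u0" by (auto simp: eventually_at_top_linorder)
  have "\<not> (\<forall>u\<ge>u0. \<phi> (l * u) \<le> ennreal (max 1 K) * \<phi> u)"
  proof
    assume "\<forall>u\<ge>u0. \<phi> (l * u) \<le> ennreal (max 1 K) * \<phi> u"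
    then have "\<exists>K'>0. \<forall>u\<ge>u0. \<phi> (2 * u) \<le> ennreal K' * \<phi> u"
      using u0(2) by (intro doubling_of_dilation[OF \<phi> l, of "max 1 K" u0]) auto
    moreover have "\<phi> u0 < \<infinity>" using u0(2) by (intro fin) simp
    ultimately show False using nd u0(2) unfolding Delta2_infty_def by blast
  qed
  then obtain u where u: "u0 \<le> u" "ennreal (max 1 K) * \<phi> u < \<phi> (l * u)" by (auto simp: not_le)
  have "ennreal K * \<phi> u \<le> ennreal (max 1 K) * \<phi> u"
    by (intro mult_right_mono ennreal_leI) auto
  also note u(2)
  finally have "ennreal K * \<phi> u < \<phi> (l * u)" .
  moreover have "ennreal c \<le> \<phi> u"
    using u0 u(1) Orlicz_function_mono[OF \<phi>, of u0 u] by simp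
  ultimately show ?thesis using u(1) u0(2) fin[of u] by (intro that[of u]) auto
qed

section \<open>The copy spanned by disjoint blocks\<close>

definition step :: "(nat \<Rightarrow> 'a set) \<Rightarrow> (nat \<Rightarrow> real) \<Rightarrow> 'a \<Rightarrow> real" where
  "step A c t = (\<Sum>k. c k * indicat_real (A k) t)"

lemma step_measurable:
  assumes [measurable]: "\<And>k. A k \<in> sets M" shows "step A c \<in> borel_measurable M"
  unfolding step_def[abs_def] by measurable

text \<open>
  By disjointness at most one term of the series is nonzero. Hence every pointwise statement about
  step functions reduces to one about a single coefficient.
\<close>

lemma step_cases:
  assumes "disjoint_family A"
  obtains (block) j where "t \<in> A j" "\<And>c. (\<lambda>k. c k * indicat_real (A k) t) sums c j" "\<And>c. step A c t = c j"
  | (off) "\<And>k. t \<notin> A k" "\<And>c. (\<lambda>k. c k * indicat_real (A k) t) sums 0" "\<And>c. step A c t = 0"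
proof (cases "\<exists>j. t \<in> A j")
  case True
  then obtain j where j: "t \<in> A j" by blast
  have "t \<notin> A k" if "k \<noteq> j" for k using assms j that by (auto simp: disjoint_family_on_def)
  then have "(\<lambda>k. c k * indicat_real (A k) t) sums c j" for c
    using sums_finite[of "{j}" "\<lambda>k. c k * indicat_real (A k) t"] j by simp
  with j show ?thesis by (intro block) (auto simp: step_def sums_iff)
next
  case False
  then show ?thesis by (intro off) (auto simp: step_def)
qed

lemma step_on_block:
  assumes "disjoint_family A" "t \<in> A k"
  shows "step A c t = c k"
proof (rule step_cases[OF assms(1), of t])
  fix j assume "t \<in> A j" and c: "\<And>c. step A c t = c j"
  then have "j = k" using assms by (auto simp: disjoint_family_on_def)
  with c show ?thesis by blast
qed (use assms in auto)

lemma step_compose: "disjoint_family A \<Longrightarrow> f 0 = 0 \<Longrightarrow> f (step A c t) = step A (\<lambda>k. f (c k)) t"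
  by (rule step_cases[of A t]) auto

context Fatou_ideal_space
begin

text \<open>
  Disjointness lets \<open>\<phi>\<close> act on the coefficients, so that \<open>\<phi>\<close> of the step function is a sum of multiples
  of indicators with geometrically small quasi-norms.
\<close>

lemma rho_step_le_1:
  assumes \<phi>: "Orlicz_function \<phi>" and A: "disjoint_family A" "\<And>k. A k \<in> sets M"
    "\<And>k. indicat_real (A k) \<in> E"
    and fin: "\<And>k. \<phi> (u k) < \<infinity>"
    and small: "\<And>k. \<phi> (u k) * ennreal (set_norm (A k)) \<le> ennreal ((1 / (2 * C)) ^ Suc k)"
    and c: "\<And>k. \<bar>c k\<bar> \<le> u k"
  shows "rho M E N \<phi> (step A c) \<le> 1"
proof -
  have le: "\<phi> \<bar>c k\<bar> \<le> \<phi> (u k)" for k using c by (intro Orlicz_function_mono[OF \<phi>]) auto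
  have fin': "\<phi> \<bar>c k\<bar> < \<infinity>" for k using le fin by (rule le_less_trans)
  define g where "g k = enn2real (\<phi> \<bar>c k\<bar>)" for k
  have g: "\<phi> \<bar>c k\<bar> = ennreal (g k)" "0 \<le> g k" for k using fin'[of k] by (auto simp: g_def)
  have comp: "enn2real (\<phi> \<bar>step A c t\<bar>) = step A g t" for t
    using step_compose[OF A(1), of "\<lambda>v. enn2real (\<phi> \<bar>v\<bar>)"] Orlicz_function_0[OF \<phi>]
    by (simp add: g_def[abs_def])
  have finite: "\<phi> \<bar>step A c t\<bar> < \<infinity>" for t
    by (cases rule: step_cases[OF A(1), where t = t]) (auto simp: fin'[simplified] Orlicz_function_0[OF \<phi>])
  let ?f = "\<lambda>k t. g k * indicat_real (A k) t"
  have f1: "?f k \<in> E" for k using A(3) by (rule scale_E)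
  have f2: "0 \<le> ?f k t" for k t using g(2) by simp
  have f3: "N (?f k) \<le> (1 / (2 * C)) ^ Suc k" for k
  proof -
    have "ennreal (g k * set_norm (A k)) = \<phi> \<bar>c k\<bar> * ennreal (set_norm (A k))"
      using g N_nonneg[OF A(3)] by (simp add: ennreal_mult)
    also have "\<dots> \<le> \<phi> (u k) * ennreal (set_norm (A k))" using le by (rule mult_right_mono) simp
    also have "\<dots> \<le> ennreal ((1 / (2 * C)) ^ Suc k)" by (rule small)
    finally show ?thesis using g(2) C_ge_1 by (simp add: N_scale[OF A(3)] ennreal_le_iff)
  qed
  have sums: "AE t in M. (\<lambda>k. ?f k t) sums step A g t"
  proof (rule AE_I2)
    fix t show "(\<lambda>k. ?f k t) sums step A g t" by (cases rule: step_cases[OF A(1), where t = t]) auto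
  qed
  have gE: "step A g \<in> E"
    by (rule geometric_sum_E[OF f1 f2 f3 step_measurable[OF A(2)] sums])
  have gN: "N (step A g) \<le> 1"
    by (rule geometric_sum_N_le_1[OF f1 f2 f3 step_measurable[OF A(2)] sums])
  show ?thesis using gE gN finite by (simp add: rho_def comp)
qed

text \<open>
  The value \<open>\<phi> v = \<infinity>\<close> is allowed: then \<open>A\<close> is null as soon as the right-hand side is finite, and the
  product is \<open>\<infinity> * 0 = 0\<close>.
\<close>

lemma rho_ge_on_set:
  assumes \<phi>: "Orlicz_function \<phi>" and A: "A \<in> sets M" "indicat_real A \<in> E"
    and v: "0 \<le> v" "\<And>t. t \<in> A \<Longrightarrow> v \<le> \<bar>y t\<bar>"
  shows "\<phi> v * ennreal (set_norm A) \<le> rho M E N \<phi> y"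
proof (cases "(AE t in M. \<phi> \<bar>y t\<bar> < \<infinity>) \<and> (\<lambda>t. enn2real (\<phi> \<bar>y t\<bar>)) \<in> E")
  case True
  then have fin: "AE t in M. \<phi> \<bar>y t\<bar> < \<infinity>" and gE: "(\<lambda>t. enn2real (\<phi> \<bar>y t\<bar>)) \<in> E" by auto
  have rho: "rho M E N \<phi> y = ennreal (N (\<lambda>t. enn2real (\<phi> \<bar>y t\<bar>)))" using True by (simp add: rho_def)
  have le: "\<phi> v \<le> \<phi> \<bar>y t\<bar>" if "t \<in> A" for t using v that by (intro Orlicz_function_mono[OF \<phi>]) auto
  show ?thesis
  proof (cases "\<phi> v")
    case (real p)
    have "AE t in M. \<bar>p * indicat_real A t\<bar> \<le> \<bar>enn2real (\<phi> \<bar>y t\<bar>)\<bar>"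
      using fin
    proof eventually_elim
      case (elim t)
      then show ?case using le[of t] real by (cases "\<phi> \<bar>y t\<bar>") (auto simp: indicator_def)
    qed
    then have "N (\<lambda>t. p * indicat_real A t) \<le> N (\<lambda>t. enn2real (\<phi> \<bar>y t\<bar>))"
      using E_measurable[OF scale_E[OF A(2)]] by (intro solid_N[OF gE]) auto
    then have "p * set_norm A \<le> N (\<lambda>t. enn2real (\<phi> \<bar>y t\<bar>))" using real by (simp add: N_scale[OF A(2)])
    then show ?thesis using real N_nonneg[OF A(2)] unfolding rho
      by (simp add: ennreal_mult[symmetric] ennreal_leI)
  next
    case top
    have "AE t in M. indicat_real A t = 0"
      using fin by eventually_elim (use le top in \<open>auto simp: indicator_def top_unique\<close>)
    then have "set_norm A = 0" using N_eq_0_iff[OF A(2)] by blast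
    then show ?thesis by simp
  qed
next
  case False
  then show ?thesis unfolding rho_def by (subst if_not_P) auto
qed

text \<open>
  The image of \<open>z\<close> takes the value \<open>z (n k) * u k\<close> on \<open>A k\<close>, where \<open>n\<close> takes every value infinitely often.
  Since all the blocks together have modular at most \<open>1\<close>, the norm of the image is at most
  \<open>l_infty_norm z\<close>. The coordinate \<open>z i\<close> is attached to blocks with arbitrarily large \<open>k\<close>, and on them a
  dilation by \<open>1 + 1 / Suc k\<close> already pushes the modular above \<open>1\<close>. So no \<open>l < \<bar>z i\<bar>\<close> is admissible in
  the infimum that defines the norm.
\<close>

lemma copy_of_blocks:
  assumes \<phi>: "Orlicz_function \<phi>" and A: "disjoint_family A" "\<And>k. A k \<in> sets M"
    "\<And>k. indicat_real (A k) \<in> E"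
    and u: "\<And>k. 0 \<le> u k" "\<And>k. \<phi> (u k) < \<infinity>"
    and small: "\<And>k. \<phi> (u k) * ennreal (set_norm (A k)) \<le> ennreal ((1 / (2 * C)) ^ Suc k)"
    and large: "\<And>k. 1 < \<phi> ((1 + 1 / Suc k) * u k) * ennreal (set_norm (A k))"
  shows "contains_order_isometric_copy_l_infty M (E_phi M E N \<phi>) (norm_phi M E N \<phi>)"
proof -
  \<comment> \<open>Pairs \<open>(i, m)\<close> are coded by numbers, and \<open>m\<close> can be chosen as large as needed.\<close>
  define n where "n k = fst (prod_decode k)" for k
  define P where "P z = step A (\<lambda>k. z (n k) * u k)" for z :: "nat \<Rightarrow> real"
  have abs_le: "\<bar>z i\<bar> \<le> l_infty_norm z" if "z \<in> l_infty" for z i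
  proof -
    obtain B where "\<And>i. \<bar>z i\<bar> \<le> B" using \<open>z \<in> l_infty\<close> by (auto simp: l_infty_def Bseq_def)
    then have "bdd_above (range (\<lambda>i. \<bar>z i\<bar>))" by (intro bdd_aboveI[of _ B]) auto
    then show ?thesis unfolding l_infty_norm_def by (intro cSUP_upper) auto
  qed
  have upper: "rho M E N \<phi> (\<lambda>t. P z t / l) \<le> 1" if z: "z \<in> l_infty" and l: "0 < l" "l_infty_norm z \<le> l" for z l
  proof -
    have eq: "(\<lambda>t. P z t / l) = step A (\<lambda>k. z (n k) * u k / l)"
      unfolding P_def using step_compose[OF A(1), of "\<lambda>v. v / l"] by auto
    have "\<bar>z (n k) * u k / l\<bar> \<le> u k" for k
    proof -
      have "\<bar>z (n k)\<bar> \<le> l" using abs_le[OF z, of "n k"] l by linarith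
      then have "\<bar>z (n k)\<bar> * u k \<le> l * u k" using u(1) by (intro mult_right_mono) auto
      then show ?thesis using l u(1)[of k] by (simp add: abs_mult field_simps)
    qed
    then show ?thesis unfolding eq by (intro rho_step_le_1[OF \<phi> A u(2) small])
  qed
  have lower: "\<bar>z i\<bar> \<le> l" if l: "0 < l" and le: "rho M E N \<phi> (\<lambda>t. P z t / l) \<le> 1" for z l i
  proof (rule ccontr)
    assume "\<not> \<bar>z i\<bar> \<le> l"
    then have "0 < \<bar>z i\<bar> / l - 1" using l by (simp add: field_simps)
    then obtain m where "1 / Suc m < \<bar>z i\<bar> / l - 1" using nat_approx_posE by blast
    moreover define k where "k = prod_encode (i, m)"
    moreover have "1 / Suc k \<le> 1 / Suc m"
      using le_prod_encode_2[of m i] by (simp add: k_def field_simps)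
    ultimately have k: "1 + 1 / Suc k \<le> \<bar>z i\<bar> / l" "n k = i" by (auto simp: n_def)
    have "(1 + 1 / Suc k) * u k \<le> \<bar>P z t / l\<bar>" if "t \<in> A k" for t
    proof -
      have "P z t = z i * u k"
        unfolding P_def using step_on_block[OF A(1) that] k(2) by simp
      moreover have "(1 + 1 / Suc k) * u k \<le> \<bar>z i\<bar> / l * u k"
        using k(1) u(1) by (rule mult_right_mono)
      ultimately show ?thesis using l u(1)[of k] by (simp add: abs_mult)
    qed
    then have "\<phi> ((1 + 1 / Suc k) * u k) * ennreal (set_norm (A k)) \<le> rho M E N \<phi> (\<lambda>t. P z t / l)"
      using u(1)[of k] by (intro rho_ge_on_set[OF \<phi> A(2,3)]) auto
    with large[of k] le show False by simp
  qed
  have norm: "norm_phi M E N \<phi> (P z) = l_infty_norm z" if z: "z \<in> l_infty" for z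
  proof -
    let ?S = "{l. 0 < l \<and> rho M E N \<phi> (\<lambda>t. P z t / l) \<le> 1}"
    have nn: "0 \<le> l_infty_norm z" using abs_le[OF z, of 0] by linarith
    have inS: "l \<in> ?S" if "0 < l" "l_infty_norm z \<le> l" for l using upper[OF z that] that by simp
    have "l_infty_norm z + 1 \<in> ?S" using nn by (intro inS) auto
    then have ne: "?S \<noteq> {}" by blast
    have bdd: "bdd_below ?S" by (intro bdd_belowI[of _ 0]) auto
    have "l_infty_norm z \<le> Inf ?S"
      unfolding l_infty_norm_def using lower by (intro cSUP_least cInf_greatest[OF ne]) auto
    moreover have "Inf ?S \<le> l_infty_norm z"
    proof (rule field_le_epsilon)
      fix e :: real assume "0 < e"
      then show "Inf ?S \<le> l_infty_norm z + e" using nn by (intro cInf_lower[OF inS bdd]) auto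
    qed
    ultimately show ?thesis unfolding norm_phi_def by simp
  qed
  have "P z \<in> E_phi M E N \<phi>" if z: "z \<in> l_infty" for z
  proof -
    define l where "l = l_infty_norm z + 1"
    have l: "0 < l" "l_infty_norm z \<le> l" using abs_le[OF z, of 0] by (auto simp: l_def)
    have "rho M E N \<phi> (\<lambda>t. (1 / l) * P z t) < \<infinity>"
      using upper[OF z l] by (simp add: le_less_trans)
    moreover have "P z \<in> borel_measurable M" unfolding P_def using A(2) by (rule step_measurable)
    ultimately show ?thesis using l unfolding E_phi_def by (auto intro!: exI[of _ "1 / l"])
  qed
  moreover have "P (\<lambda>k. z k + w k) t = P z t + P w t" for z w t
    unfolding P_def by (cases rule: step_cases[OF A(1), where t = t]) (auto simp: algebra_simps)
  moreover have "P (\<lambda>k. c * z k) t = c * P z t" for c z t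
    unfolding P_def by (cases rule: step_cases[OF A(1), where t = t]) (auto simp: algebra_simps)
  moreover have "\<bar>P z t\<bar> = P (\<lambda>k. \<bar>z k\<bar>) t" for z t
    unfolding P_def using u(1) by (cases rule: step_cases[OF A(1), where t = t]) (auto simp: abs_mult)
  ultimately show ?thesis
    unfolding contains_order_isometric_copy_l_infty_def using norm by (intro exI[of _ P]) auto
qed

end

section \<open>Construction of the blocks\<close>

text \<open>
  The size \<open>s\<close> of a block is dictated by \<open>v = \<phi> u\<close> and \<open>w = \<phi> (l * u)\<close>: a first
  choice is \<open>e / v\<close>, the largest size that keeps \<open>v * s\<close> below \<open>e\<close>. For \<open>v = 0\<close> the size must instead be
  large compared with \<open>1 / w\<close>, and for \<open>w = \<infinity>\<close> any small size will do. In the last clause \<open>r\<close> is the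
  size of a set that has to contain the block. The factor \<open>2 * C\<close> pays for the loss in
  \<open>set_norm_intermediate\<close>.
\<close>

lemma block_scale:
  fixes v w :: ennreal
  assumes v: "v < \<infinity>" and e: "0 < e" and C: "0 < C" and vw: "ennreal (2 * C / e) * v < w"
  obtains s where "0 < s" "v * ennreal s \<le> ennreal e" "ennreal (2 * C) < w * ennreal s"
    "0 < r \<and> (w = \<infinity> \<or> ennreal (2 * e / r) \<le> v) \<longrightarrow> s < r"
proof (cases w)
  case top
  obtain v' where v': "v = ennreal v'" "0 \<le> v'" using v by (cases v) auto
  define s where "s = min (e / (v' + 1)) (if 0 < r then r / 2 else 1)"
  have s: "0 < s" "0 < r \<longrightarrow> s < r" using e v' by (auto simp: s_def min_less_iff_disj)
  have "v' * s \<le> v' * (e / (v' + 1))" using v' by (intro mult_left_mono) (auto simp: s_def)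
  also have "\<dots> \<le> e" using v' e by (simp add: field_simps)
  finally have "v * ennreal s \<le> ennreal e" using v' s by (simp add: ennreal_mult[symmetric] ennreal_leI)
  moreover have "ennreal (2 * C) < w * ennreal s" using top s by (simp add: ennreal_top_mult)
  ultimately show ?thesis using s that by blast
next
  case (real w')
  obtain v' where v': "v = ennreal v'" "0 \<le> v'" using v by (cases v) auto
  have less: "2 * C / e * v' < w'"
    using vw v' real e C by (simp add: ennreal_mult[symmetric] ennreal_less_iff)
  define s where "s = (if v' = 0 then 4 * C / w' else e / v')"
  have w'_pos: "0 < w'" using less v' e C by (smt (verit) divide_nonneg_nonneg mult_nonneg_nonneg)
  have s: "0 < s" using w'_pos v' e C by (auto simp: s_def)
  have "v' * s \<le> e" using e by (simp add: s_def)
  then have "v * ennreal s \<le> ennreal e" using v' s by (simp add: ennreal_mult[symmetric] ennreal_leI)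
  moreover have "2 * C < w' * s"
    using less w'_pos v' e C by (auto simp: s_def field_simps)
  then have "ennreal (2 * C) < w * ennreal s"
    using real s C by (simp add: ennreal_mult[symmetric] ennreal_less_iff)
  moreover have "s < r" if r: "0 < r" "w = \<infinity> \<or> ennreal (2 * e / r) \<le> v"
  proof -
    have "2 * e / r \<le> v'" using r v' real e by (auto simp: ennreal_le_iff)
    then have "2 * e \<le> v' * r" using r by (simp add: field_simps)
    then have "e < r * v'" "0 < v'" using e v' by (auto simp: mult.commute intro: le_neq_trans)
    then show ?thesis by (simp add: s_def pos_divide_less_eq)
  qed
  ultimately show ?thesis using s that by blast
qed

context Fatou_ideal_space
begin

definition is_block :: "(real \<Rightarrow> ennreal) \<Rightarrow> nat \<Rightarrow> real \<Rightarrow> 'a set \<Rightarrow> bool" where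
  "is_block \<phi> k u A \<longleftrightarrow> A \<in> sets M \<and> indicat_real A \<in> E \<and> 0 \<le> u \<and> \<phi> u < \<infinity> \<and>
     \<phi> u * ennreal (set_norm A) \<le> ennreal ((1 / (2 * C)) ^ Suc k) \<and>
     1 < \<phi> ((1 + 1 / Suc k) * u) * ennreal (set_norm A)"

lemma block_exists:
  assumes atomless: "nonatomic M" and R: "R \<in> sets M" "indicat_real R \<in> Ea"
    and s: "0 < s" "s < set_norm R" and u: "0 \<le> u" "\<phi> u < \<infinity>"
    and small: "\<phi> u * ennreal s \<le> ennreal ((1 / (2 * C)) ^ Suc k)"
    and large: "ennreal (2 * C) < \<phi> ((1 + 1 / Suc k) * u) * ennreal s"
  shows "\<exists>A. is_block \<phi> k u A \<and> A \<subseteq> R"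
proof -
  obtain A where A: "A \<in> sets M" "A \<subseteq> R" "s / (2 * C) \<le> set_norm A" "set_norm A \<le> s"
    by (rule set_norm_intermediate[OF atomless R s])
  let ?w = "\<phi> ((1 + 1 / Suc k) * u)"
  have "\<phi> u * ennreal (set_norm A) \<le> \<phi> u * ennreal s"
    using A(4) by (intro mult_left_mono ennreal_leI) auto
  also note small
  finally have le: "\<phi> u * ennreal (set_norm A) \<le> ennreal ((1 / (2 * C)) ^ Suc k)" .
  have "1 = ennreal (2 * C) * ennreal (1 / (2 * C))"
    using C_ge_1 by (simp add: ennreal_mult[symmetric])
  also have "\<dots> < ?w * ennreal s * ennreal (1 / (2 * C))"
    using large C_ge_1 by (intro ennreal_mult_strict_right_mono) auto
  also have "\<dots> = ?w * ennreal (s / (2 * C))"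
    using s C_ge_1 by (simp add: mult.assoc ennreal_mult[symmetric])
  also have "\<dots> \<le> ?w * ennreal (set_norm A)"
    using A(3) by (intro mult_left_mono ennreal_leI) auto
  finally have "1 < ?w * ennreal (set_norm A)" .
  moreover have "indicat_real A \<in> E"
    by (rule Ea_E[OF indicator_subset_Ea[OF R(2) A(1,2)]])
  ultimately show ?thesis using A u le unfolding is_block_def by blast
qed

text \<open>
  Blocks are chosen one after another from what the previous ones have left. \<open>Big\<close> is any invariant of
  the remaining set that guarantees room for the next block.
\<close>

lemma copy_of_block_supply:
  assumes \<phi>: "Orlicz_function \<phi>" and "Big R0"
    and next_block: "\<And>R k. Big R \<Longrightarrow> \<exists>u A. is_block \<phi> k u A \<and> A \<subseteq> R \<and> Big (R - A)"
  shows "contains_order_isometric_copy_l_infty M (E_phi M E N \<phi>) (norm_phi M E N \<phi>)"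
proof -
  define good where "good k X \<longleftrightarrow> (case X of (R, u, A) \<Rightarrow> is_block \<phi> k u A \<and> A \<subseteq> R \<and> Big (R - A))"
    for k and X :: "'a set \<times> real \<times> 'a set"
  have "\<exists>X. \<forall>k. good k (X k) \<and> fst (X (Suc k)) = fst (X k) - snd (snd (X k))"
  proof (rule dependent_nat_choice)
    show "\<exists>X. good 0 X" using next_block[OF \<open>Big R0\<close>, of 0] by (auto simp: good_def)
  next
    fix X k assume "good k X"
    then have "Big (fst X - snd (snd X))" by (auto simp: good_def)
    from next_block[OF this, of "Suc k"]
    show "\<exists>Y. good (Suc k) Y \<and> fst Y = fst X - snd (snd X)" by (auto simp: good_def)
  qed
  then obtain X where X: "\<And>k. good k (X k)" "\<And>k. fst (X (Suc k)) = fst (X k) - snd (snd (X k))"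
    by blast
  define R where "R k = fst (X k)" for k
  define u where "u k = fst (snd (X k))" for k
  define A where "A k = snd (snd (X k))" for k
  have blk: "is_block \<phi> k (u k) (A k)" and AR: "A k \<subseteq> R k" for k
    using X(1)[of k] by (auto simp: good_def R_def u_def A_def split: prod.splits)
  have R_Suc: "R (Suc k) = R k - A k" for k using X(2) by (simp add: R_def A_def)
  have dec: "decseq R" by (rule decseq_SucI) (auto simp: R_Suc)
  have disj: "A i \<inter> A j = {}" if "i < j" for i j
    using AR[of j] decseqD[OF dec, of "Suc i" j] that unfolding R_Suc by auto
  have "disjoint_family A"
    unfolding disjoint_family_on_def
  proof (intro ballI impI)
    fix i j :: nat assume "i \<noteq> j"
    then show "A i \<inter> A j = {}" using disj[of i j] disj[of j i] by (cases "i < j") auto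
  qed
  then show ?thesis
    using blk unfolding is_block_def by (intro copy_of_blocks[OF \<phi>, of A u]) auto
qed

text \<open>
  All the blocks lie in one set \<open>B\<close> with indicator in \<open>Ea\<close>, and remaining sets are \<open>Big\<close> if they have positive
  measure. Before a block is chosen, a part of positive measure is reserved for the later ones.
  As \<open>set_norm\<close> is bounded on subsets of \<open>B\<close>, the blocks have to be small. This is why
  \<open>\<phi> u\<close> must be large or \<open>\<phi> (l * u)\<close> infinite.
\<close>

lemma copy_if_not_Delta2_infty:
  assumes \<phi>: "Orlicz_function \<phi>" and atomless: "nonatomic M" and ab: "a_param \<phi> < b_param \<phi>"
    and x: "x \<in> Ea" "\<not> (AE t in M. x t = 0)" and nd: "\<not> Delta2_infty \<phi>"
  shows "contains_order_isometric_copy_l_infty M (E_phi M E N \<phi>) (norm_phi M E N \<phi>)"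
proof -
  have nz: "\<not> (AE t in M. t \<in> space M \<longrightarrow> x t = 0)"
  proof
    assume "AE t in M. t \<in> space M \<longrightarrow> x t = 0"
    then have "AE t in M. x t = 0" using AE_space by eventually_elim auto
    with x(2) show False by blast
  qed
  obtain B where B: "B \<in> sets M" "B \<subseteq> space M" "indicat_real B \<in> Ea" "0 < emeasure M B"
    by (rule Ea_nonzero_indicator[OF x(1) sets.top nz])
  define Big where "Big R \<longleftrightarrow> R \<in> sets M \<and> R \<subseteq> B \<and> 0 < emeasure M R" for R
  have "Big B" using B by (simp add: Big_def)
  moreover have "\<exists>u A. is_block \<phi> k u A \<and> A \<subseteq> R \<and> Big (R - A)" if "Big R" for R k
  proof -
    have R: "R \<in> sets M" "R \<subseteq> B" "0 < emeasure M R" using that by (auto simp: Big_def)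
    obtain D :: "nat \<Rightarrow> 'a set" where D: "disjoint_family D"
      and D_all: "\<forall>i. D i \<in> sets M \<and> D i \<subseteq> R \<and> 0 < emeasure M (D i)"
      using nonatomic_disjoint_subsets[OF atomless R(1,3)] by blast
    \<comment> \<open>The block is sought in \<open>D 0\<close>, while \<open>D 1\<close> is kept for the later blocks.\<close>
    define R1 where "R1 = D 0"
    have R1: "R1 \<in> sets M" "R1 \<subseteq> R" "0 < emeasure M R1" using D_all by (auto simp: R1_def)
    have R1_Ea: "indicat_real R1 \<in> Ea" using R1 R by (intro indicator_subset_Ea[OF B(3)]) auto
    have pos: "0 < set_norm R1" using R1 Ea_E[OF R1_Ea] by (intro set_norm_pos)
    let ?e = "(1 / (2 * C)) ^ Suc k"
    have e: "0 < ?e" using C_ge_1 by simp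
    obtain u where u: "0 \<le> u" "\<phi> u < \<infinity>" "ennreal (2 * C / ?e) * \<phi> u < \<phi> ((1 + 1 / Suc k) * u)"
      "\<phi> ((1 + 1 / Suc k) * u) = \<infinity> \<or> ennreal (2 * ?e / set_norm R1) \<le> \<phi> u"
    proof (rule not_Delta2_infty_dilation[OF \<phi> ab nd, of "1 + 1 / Suc k" "2 * C / ?e" "2 * ?e / set_norm R1"])
      show "0 < 2 * C / ?e" using C_ge_1 e by simp
    qed auto
    have C0: "0 < C" using C_ge_1 by simp
    obtain s where s: "0 < s" "\<phi> u * ennreal s \<le> ennreal ?e"
      "ennreal (2 * C) < \<phi> ((1 + 1 / Suc k) * u) * ennreal s"
      "0 < set_norm R1 \<and> (\<phi> ((1 + 1 / Suc k) * u) = \<infinity> \<or> ennreal (2 * ?e / set_norm R1) \<le> \<phi> u)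
        \<longrightarrow> s < set_norm R1"
      by (rule block_scale[OF u(2) e C0 u(3)])
    have "s < set_norm R1" using s(4) u(4) pos by blast
    from block_exists[OF atomless R1(1) R1_Ea s(1) this u(1,2) s(2,3)]
    obtain A where A: "is_block \<phi> k u A" "A \<subseteq> R1" by blast
    have AM: "A \<in> sets M" using A by (simp add: is_block_def)
    have "D 0 \<inter> D 1 = {}" using D by (simp add: disjoint_family_on_def)
    then have "D 1 \<subseteq> R - A" using A(2) D_all unfolding R1_def by blast
    then have "emeasure M (D 1) \<le> emeasure M (R - A)" using R AM by (intro emeasure_mono) auto
    moreover have "0 < emeasure M (D 1)" using D_all by blast
    ultimately have "0 < emeasure M (R - A)" by (rule order.strict_trans2[rotated])
    then have "Big (R - A)" using R AM by (auto simp: Big_def)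
    with A R1(2) show ?thesis by blast
  qed
  ultimately show ?thesis by (rule copy_of_block_supply[OF \<phi>])
qed

text \<open>
  Now the doubling condition may fail only near \<open>0\<close>, or at points where \<open>\<phi>\<close> vanishes, and
  blocks of arbitrarily large size are required. Remaining sets are \<open>Big\<close> if their indicator is not in \<open>E\<close>:
  this holds for the whole space because some bounded function is not in \<open>E\<close>, it survives the removal
  of a block because indicators of blocks are in \<open>E\<close>, and it gives room by \<open>Ea_large_subset\<close>.
\<close>

lemma copy_if_not_Delta2_Rplus:
  assumes \<phi>: "Orlicz_function \<phi>" and atomless: "nonatomic M" and not_Linf: "\<not> Linf M \<subseteq> E"
    and supp: "is_support M Ea (space M)" and nd: "\<not> Delta2_Rplus \<phi>"
  shows "contains_order_isometric_copy_l_infty M (E_phi M E N \<phi>) (norm_phi M E N \<phi>)"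
proof -
  define Big where "Big R \<longleftrightarrow> R \<in> sets M \<and> indicat_real R \<notin> E" for R
  have "indicat_real (space M) \<notin> E"
  proof
    assume E1: "indicat_real (space M) \<in> E"
    have "x \<in> E" if x: "x \<in> borel_measurable M" "AE t in M. \<bar>x t\<bar> \<le> c" for x c
    proof (rule solid_E[OF scale_E[OF E1] x(1)])
      show "AE t in M. \<bar>x t\<bar> \<le> \<bar>c * indicat_real (space M) t\<bar>"
        using x(2) AE_space by eventually_elim (simp add: order_trans[OF _ abs_ge_self])
    qed
    then have "Linf M \<subseteq> E" by (auto simp: Linf_def)
    with not_Linf show False by blast
  qed
  then have "Big (space M)" by (simp add: Big_def)
  moreover have "\<exists>u A. is_block \<phi> k u A \<and> A \<subseteq> R \<and> Big (R - A)" if "Big R" for R k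
  proof -
    have R: "R \<in> sets M" "indicat_real R \<notin> E" using that by (auto simp: Big_def)
    let ?e = "(1 / (2 * C)) ^ Suc k"
    have e: "0 < ?e" and C0: "0 < C" using C_ge_1 by auto
    obtain u where u: "0 \<le> u" "\<phi> u < \<infinity>" "ennreal (2 * C / ?e) * \<phi> u < \<phi> ((1 + 1 / Suc k) * u)"
    proof (rule not_Delta2_Rplus_dilation[OF \<phi> nd, of "1 + 1 / Suc k" "2 * C / ?e"])
      show "0 < 2 * C / ?e" using C0 e by simp
    qed auto
    obtain s where s: "0 < s" "\<phi> u * ennreal s \<le> ennreal ?e"
      "ennreal (2 * C) < \<phi> ((1 + 1 / Suc k) * u) * ennreal s"
      by (rule block_scale[OF u(2) e C0 u(3)])
    obtain B where B: "B \<in> sets M" "B \<subseteq> R" "indicat_real B \<in> Ea" "s < set_norm B"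
      by (rule Ea_large_subset[OF supp R])
    from block_exists[OF atomless B(1,3) s(1) B(4) u(1,2) s(2,3)]
    obtain A where A: "is_block \<phi> k u A" "A \<subseteq> B" by blast
    have AM: "A \<in> sets M" "indicat_real A \<in> E" using A by (simp_all add: is_block_def)
    have "indicat_real (R - A) \<notin> E"
    proof
      assume "indicat_real (R - A) \<in> E"
      then have "indicat_real (A \<union> (R - A)) \<in> E" using AM R by (intro indicator_Un_E) auto
      moreover have "A \<union> (R - A) = R" using A(2) B(2) by blast
      ultimately show False using R by simp
    qed
    then have "Big (R - A)" using R AM by (simp add: Big_def)
    with A B(2) show ?thesis by blast
  qed
  ultimately show ?thesis by (rule copy_of_block_supply[OF \<phi>])
qed

end

theorem corollary5p4:
  fixes M :: "'a measure"
    and E :: "('a \<Rightarrow> real) set"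
    and N :: "('a \<Rightarrow> real) \<Rightarrow> real"
    and \<phi> :: "real \<Rightarrow> ennreal"
  assumes "complete_measure M" and "sigma_finite_measure M" and "emeasure M (space M) > 0"
    and "quasi_Banach_ideal_space M E N" and "Fatou_property M E N"
    and "Orlicz_function \<phi>" and "a_param \<phi> < b_param \<phi>" and "alpha_E M E \<phi> > 0"
    and "nonatomic M"
  shows "(Linf M \<subseteq> E \<and> (\<exists>x\<in>order_continuous_part M E N. \<not> (AE t in M. x t = 0)) \<and>
            \<not> Delta2_infty \<phi>
            \<longrightarrow> contains_order_isometric_copy_l_infty M (E_phi M E N \<phi>) (norm_phi M E N \<phi>))
       \<and> (\<not> Linf M \<subseteq> E \<and> \<not> E \<subseteq> Linf M \<and>
            is_support M (order_continuous_part M E N) (space M) \<and>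
            \<not> Delta2_Rplus \<phi>
            \<longrightarrow> contains_order_isometric_copy_l_infty M (E_phi M E N \<phi>) (norm_phi M E N \<phi>))"
proof -
  obtain C where C: "1 \<le> C" "\<forall>x\<in>E. \<forall>y\<in>E. N (\<lambda>t. x t + y t) \<le> C * (N x + N y)"
    using assms(4) unfolding quasi_Banach_ideal_space_def quasi_norm_on_def by blast
  interpret sigma_finite_measure M by fact
  interpret Fatou_ideal_space M E N C
    using assms(4,5) C by unfold_locales auto
  show ?thesis
    using copy_if_not_Delta2_infty[OF assms(6,9,7)] copy_if_not_Delta2_Rplus[OF assms(6,9)] by blast
qed

end
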